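(* Suppose that $k\,\|\tau\circ\varphi\|_\infty<2$, where $\|\tau\circ\varphi\|_\infty$ is the supremum of $|\tau(\varphi(x,t))|$ over $(x,t)\in\Omega\times(0,T)$. Then, for each $j=1,2,\dots$, there exists a sequence $\{\bar u_h^{2j,n}\}_{n=0}^N$ of elements of the form $\bar u_h^{2j,n}=\sum_{l=1}^{N_h}U_l^{2j,n}\phi_l$ satisfying the fully discrete scheme DC$(2j)$ described in the context, including the initial condition $\bar u_h^{2j,0}=R_h(u_0-\varphi(0))$.
   Context: **Problem.** $\Omega\subset\mathbb R^d$ ($d\in\{1,2,3\}$) is a bounded domain with smooth boundary, $T>0$, $J\ge1$ an integer, $M$ a constant positive definite $J\times J$ matrix. $f:\mathbb R^J\to\mathbb R^J$ is smooth and there are $\alpha\ge0$, $q\ge1$, $\mu_0\ge0$ and a continuous $\tau:\mathbb R^J\to\mathbb R$ with $(f(x)-f(y))\cdot(x-y)\ge\alpha|x-y|^q+\tau(y)|x-y|^2$ and $(df(x)y)\cdot y\ge-\mu_0|y|^2$ for all $x,y\in\mathbb R^J$. $B$ denotes the Dirichlet, Neumann or mixed Dirichlet-Neumann boundary operator. For inhomogeneous Neumann boundary conditions it is also supposed that $|df(x)|\le\mu_1(1+|x|^{q-2})$ for all $x$, with $\mu_1>0$ and $2\le q<18$. $S,\varphi:\Omega\times(0,T)\to\mathbb R^J$ are given smooth functions; $\varphi$ carries the boundary data. $u:\Omega\times[0,T]\to\mathbb R^J$ is the solution of $$u'-M\Delta u+f(u)=S\ \text{in }\Omega\times(0,T),\quad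 Bu=B\varphi\ \text{on }\partial\Omega\times[0,T],\quad u(\cdot,0)=u_0,$$ assumed to be unique and to belong to $C^{2p+4}([0,T],H^{r+1}(\Omega))$ for some positive integers $p,r$. Put $\tilde S=S-\varphi'+M\Delta\varphi$; $\bar u=u-\varphi$ satisfies $\bar u'-M\Delta\bar u+f(\bar u+\varphi)=\tilde S$, $B\bar u=0$ on $\partial\Omega$, $\bar u(0)=u_0-\varphi(0)$. All function spaces are spaces of $\mathbb R^J$-valued functions; $(\cdot,\cdot)$ is the $L^2(\Omega)$ inner product. **Difference operators.** $k>0$ is the time step, $t_n=nk$, $t_{n+1/2}=(n+1/2)k$, $t_N=T$. For a sequence $v^n$ (or $v^n=v(t_n)$): $Dv^{n+1/2}=D_+v^n=D_-v^{n+1}=(v^{n+1}-v^n)/k$, $Ev^{n+1/2}=(v^{n+1}+v^n)/2$. The reals $c_i$, $i\ge2$, are those such that for every $P\ge1$ and smooth $v$, $v'(t_{n+1/2})=Dv(t_{n+1/2})-\sum_{i=1}^Pc_{2i+1}k^{2i}D(D_+D_-)^iv(t_{n+1/2})+O(k^{2P+2})$ and $v(t_{n+1/2})=Ev(t_{n+1/2})-\sum_{i=1}^Pc_{2i}k^{2i}(D_+D_-)^iEv(t_{n+1/2})+O(k^{2P+2})$ (so $c_2=\frac18$, $c_3=\frac1{24}$, $c_4=-\frac{18}{4!2^5}$, $c_5=-\frac{18}{5!2^5}$, ...). For $j\ge1$, $$\Lambda^jv^n=\sum_{i=1}^j\sum_{l=0}^{2i}c_{2i+1}(-1)^l\tbinom{2i}{l}v^{n+i-l},\qquad\Gamma^jv^n=\sum_{i=1}^j\sum_{l=0}^{2i}c_{2i}(-1)^l\tbinom{2i}{l}v^{n+i-l}.$$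 The reals $c^j_2,\dots,c^j_{2j+1}$ are those such that for smooth $v$ on $[a,b]$, with $\kappa=(b-a)/(2j+1)$, $\tau_n=a+n\kappa$, $\tau_{j+1/2}=(a+b)/2$ and $D,D_\pm,E$ taken with step $\kappa$: $v'(\tau_{j+1/2})=\frac{v(b)-v(a)}{b-a}-\frac1{b-a}\sum_{i=1}^jc^j_{2i+1}\kappa^{2i+1}D(D_+D_-)^iv(\tau_{j+1/2})+O(\kappa^{2j+2})$ and $v(\tau_{j+1/2})=\frac{v(a)+v(b)}2-\sum_{i=1}^jc^j_{2i}\kappa^{2i}(D_+D_-)^iEv(\tau_{j+1/2})+O(\kappa^{2j+2})$ (e.g. $c^1_2=c^1_3=\frac98$). With $n_j=(2j+1)n+j$, for a sequence $w$, $$\tfrac1{2j+1}\bar\Lambda^jDw^{n_j+1/2}=k^{-1}\sum_{i=1}^j\sum_{l=0}^{2i+1}c^j_{2i+1}(-1)^l\tbinom{2i+1}{l}w^{n_j+i-l+1},\qquad \bar\Gamma^jw^{m}=\sum_{i=1}^j\sum_{l=0}^{2i}c^j_{2i}(-1)^l\tbinom{2i}{l}w^{m+i-l},$$ and $\bar\Gamma^jEw^{m+1/2}=\frac12(\bar\Gamma^jw^{m+1}+\bar\Gamma^jw^m)$. **Finite elements.** $\Gamma_D\subset\partial\Omega$ is the part of the boundary where Dirichlet conditions are imposed and $V=\{v\in H^1(\Omega): v=0\text{ on }\Gamma_D\}$. $S_h\subset V$ is a finite-dimensional subspace with basis $\{\phi_l\}_{l=1}^{N_h}$ of continuous piecewise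 polynomials of degree $r\ge1$. $R_h:H^1(\Omega)\to S_h$ is the orthogonal projection with respect to $(v,w)\mapsto(v,w)+(M\nabla v,\nabla w)$. **Fully discrete scheme DC$(2j+2)$**, $j\ge0$: find $\bar u_h^{2j+2,n}=\sum_{l=1}^{N_h}U_l^{2j+2,n}\phi_l\in S_h$ with $\bar u_h^{2j+2,0}=R_h(u_0-\varphi(0))$ and, for all $\phi\in S_h$ and $n\ge j$, $$(D\bar u_h^{2j+2,n+1/2}-\Lambda^jD\bar u_h^{2j,n+1/2},\phi)+(M\nabla(E\bar u_h^{2j+2,n+1/2}-\Gamma^jE\bar u_h^{2j,n+1/2}),\nabla\phi)+(f(E\bar u_h^{2j+2,n+1/2}-\Gamma^jE\bar u_h^{2j,n+1/2}+\varphi(t_{n+1/2})),\phi)=(\tilde S(t_{n+1/2}),\phi),$$ the $\Lambda^j$ and $\Gamma^j$ terms being $0$ when $j=0$; for $0\le n\le j-1$ the same equation is used with $\Lambda^jD\bar u_h^{2j,n+1/2}$ replaced by $\frac1{2j+1}\bar\Lambda^jD\bar{\bar u}_h^{2j,n_j+1/2}$ and $\Gamma^jE\bar u_h^{2j,n+1/2}$ replaced by $\bar\Gamma^jE\bar{\bar u}_h^{2j,n_j+1/2}$, where $\bar{\bar u}_h^{2j,\cdot}$ is the DC$(2j)$ solution for time step $k/(2j+1)$. Index convention: the schemes are posed for those indices $n$ for which all data and previous-stage values entering them are defined. *)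

theory Defs
  imports "HOL-Analysis.Analysis" "HOL-Library.Landau_Symbols"
begin

section \<open>Smoothness and smooth domains\<close>

text \<open>Intended for open \<open>S\<close>.\<close>

primrec Ck_on ::
  "nat \<Rightarrow> 'a::real_normed_vector set \<Rightarrow> ('a \<Rightarrow> 'b::real_normed_vector) \<Rightarrow> bool" where
  "Ck_on 0 S g \<longleftrightarrow> continuous_on S g"
| "Ck_on (Suc m) S g \<longleftrightarrow>
     (\<forall>x\<in>S. g differentiable (at x)) \<and> (\<forall>v. Ck_on m S (\<lambda>x. frechet_derivative g (at x) v))"

definition smooth_on ::
  "'a::real_normed_vector set \<Rightarrow> ('a \<Rightarrow> 'b::real_normed_vector) \<Rightarrow> bool" where
  "smooth_on S g \<longleftrightarrow> (\<forall>m. Ck_on m S g)"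

text \<open>Smoothness up to the boundary: restrictions to \<open>K\<close> of smooth functions on the whole space.\<close>

definition smooth_upto ::
  "'a::real_normed_vector set \<Rightarrow> ('a \<Rightarrow> 'b::real_normed_vector) \<Rightarrow> bool" where
  "smooth_upto K g \<longleftrightarrow> (\<exists>h. smooth_on UNIV h \<and> (\<forall>x\<in>K. h x = g x))"

definition pd :: "'d::finite \<Rightarrow> (real^'d \<Rightarrow> 'b::real_normed_vector) \<Rightarrow> real^'d \<Rightarrow> 'b" where
  "pd i g x = frechet_derivative g (at x) (axis i 1)"

definition defining_function ::
  "(real^'d::finite) set \<Rightarrow> real^'d \<Rightarrow> (real^'d) set \<Rightarrow> (real^'d \<Rightarrow> real) \<Rightarrow> bool" where
  "defining_function \<Omega> x W \<rho> \<longleftrightarrow> open W \<and> x \<in> W \<and> smooth_on W \<rho> \<and>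
     (\<forall>y\<in>W. \<exists>i. pd i \<rho> y \<noteq> 0) \<and> \<Omega> \<inter> W = {y \<in> W. \<rho> y < 0}"

definition bounded_smooth_domain :: "(real^'d::finite) set \<Rightarrow> bool" where
  "bounded_smooth_domain \<Omega> \<longleftrightarrow> open \<Omega> \<and> connected \<Omega> \<and> \<Omega> \<noteq> {} \<and> bounded \<Omega> \<and>
     (\<forall>x\<in>frontier \<Omega>. \<exists>W \<rho>. defining_function \<Omega> x W \<rho>)"

definition outer_normal :: "(real^'d::finite) set \<Rightarrow> real^'d \<Rightarrow> real^'d" where
  "outer_normal \<Omega> x = (THE \<nu>. \<exists>W \<rho>. defining_function \<Omega> x W \<rho> \<and>
     \<nu> = (1 / norm (\<chi> i. pd i \<rho> x)) *\<^sub>R (\<chi> i. pd i \<rho> x))"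

text \<open>Surface measure: the \<open>(d-1)\<close>-dimensional Hausdorff measure on the boundary, up to the usual
  normalising constant, which is irrelevant here. The test for the empty set is needed because
  \<open>0 ^ 0 = 1\<close> (case \<open>d = 1\<close>).\<close>

definition hausdorff_outer :: "nat \<Rightarrow> 'a::metric_space set \<Rightarrow> ennreal" where
  "hausdorff_outer s A = (SUP \<delta>\<in>{0<..}.
     INF C\<in>{C :: nat \<Rightarrow> 'a set. A \<subseteq> (\<Union>i. C i) \<and> (\<forall>i. bounded (C i) \<and> diameter (C i) \<le> \<delta>)}.
       \<Sum>i. if C i = {} then 0 else ennreal (diameter (C i) ^ s))"

definition surface_measure :: "(real^'d::finite) set \<Rightarrow> (real^'d) measure" where
  "surface_measure \<Omega> =
     restrict_space (measure_of UNIV (sets borel) (hausdorff_outer (CARD('d) - 1))) (frontier \<Omega>)"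


section \<open>Sobolev spaces and traces\<close>

definition lsq :: "(real^'d::finite) set \<Rightarrow> (real^'d \<Rightarrow> real^'j::finite) set" where
  "lsq \<Omega> = {v. v \<in> borel_measurable (lebesgue_on \<Omega>) \<and>
               integrable (lebesgue_on \<Omega>) (\<lambda>x. (norm (v x))\<^sup>2)}"

definition l2_inner ::
  "(real^'d::finite) set \<Rightarrow> (real^'d \<Rightarrow> real^'j::finite) \<Rightarrow> (real^'d \<Rightarrow> real^'j) \<Rightarrow> real" where
  "l2_inner \<Omega> v w = (LINT x|lebesgue_on \<Omega>. v x \<bullet> w x)"

definition test_function :: "(real^'d::finite) set \<Rightarrow> (real^'d \<Rightarrow> real) \<Rightarrow> bool" where
  "test_function \<Omega> \<psi> \<longleftrightarrow> smooth_on UNIV \<psi> \<and>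
     compact (closure {x. \<psi> x \<noteq> 0}) \<and> closure {x. \<psi> x \<noteq> 0} \<subseteq> \<Omega>"

definition weak_partial ::
  "(real^'d::finite) set \<Rightarrow> 'd \<Rightarrow> (real^'d \<Rightarrow> real^'j::finite) \<Rightarrow> (real^'d \<Rightarrow> real^'j) \<Rightarrow> bool" where
  "weak_partial \<Omega> i v g \<longleftrightarrow> (\<forall>\<psi>. test_function \<Omega> \<psi> \<longrightarrow>
     (LINT x|lebesgue_on \<Omega>. pd i \<psi> x *\<^sub>R v x) = - (LINT x|lebesgue_on \<Omega>. \<psi> x *\<^sub>R g x))"

text \<open>A representative of the weak partial derivative; it is unique up to null sets.\<close>

definition wpd ::
  "(real^'d::finite) set \<Rightarrow> 'd \<Rightarrow> (real^'d \<Rightarrow> real^'j::finite) \<Rightarrow> real^'d \<Rightarrow> real^'j" where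
  "wpd \<Omega> i v = (SOME g. g \<in> lsq \<Omega> \<and> weak_partial \<Omega> i v g)"

primrec sobolev :: "nat \<Rightarrow> (real^'d::finite) set \<Rightarrow> (real^'d \<Rightarrow> real^'j::finite) set" where
  "sobolev 0 \<Omega> = lsq \<Omega>"
| "sobolev (Suc m) \<Omega> = {v \<in> lsq \<Omega>. \<forall>i. \<exists>g\<in>sobolev m \<Omega>. weak_partial \<Omega> i v g}"

text \<open>Square of a norm equivalent to the usual one on \<open>sobolev m \<Omega>\<close> (mixed derivatives are counted
  with multiplicity).\<close>

primrec sobolev_sqnorm ::
  "nat \<Rightarrow> (real^'d::finite) set \<Rightarrow> (real^'d \<Rightarrow> real^'j::finite) \<Rightarrow> real" where
  "sobolev_sqnorm 0 \<Omega> v = l2_inner \<Omega> v v"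
| "sobolev_sqnorm (Suc m) \<Omega> v = l2_inner \<Omega> v v + (\<Sum>i\<in>UNIV. sobolev_sqnorm m \<Omega> (wpd \<Omega> i v))"

text \<open>The trace operator is the continuous extension of the restriction to the boundary, from smooth
  functions to \<open>sobolev 1 \<Omega>\<close>, with values in the square-integrable functions on the boundary.\<close>

definition has_trace ::
  "(real^'d::finite) set \<Rightarrow> (real^'d \<Rightarrow> real^'j::finite) \<Rightarrow> (real^'d \<Rightarrow> real^'j) \<Rightarrow> bool" where
  "has_trace \<Omega> v g \<longleftrightarrow> g \<in> borel_measurable (surface_measure \<Omega>) \<and>
     (\<exists>vs. (\<forall>m. smooth_on UNIV (vs m)) \<and>
        (\<lambda>m. sobolev_sqnorm 1 \<Omega> (\<lambda>x. vs m x - v x)) \<longlonglongrightarrow> 0 \<and>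
        (\<lambda>m. \<integral>\<^sup>+ x. ennreal ((norm (vs m x - g x))\<^sup>2) \<partial>surface_measure \<Omega>) \<longlonglongrightarrow> 0)"

definition trace ::
  "(real^'d::finite) set \<Rightarrow> (real^'d \<Rightarrow> real^'j::finite) \<Rightarrow> real^'d \<Rightarrow> real^'j" where
  "trace \<Omega> v = (SOME g. has_trace \<Omega> v g)"

definition normal_trace ::
  "(real^'d::finite) set \<Rightarrow> (real^'d \<Rightarrow> real^'j::finite) \<Rightarrow> real^'d \<Rightarrow> real^'j" where
  "normal_trace \<Omega> v x = (\<Sum>i\<in>UNIV. (outer_normal \<Omega> x $ i) *\<^sub>R trace \<Omega> (wpd \<Omega> i v) x)"

text \<open>\<open>Bv = Bw\<close> for the boundary operator with Dirichlet part \<open>\<Gamma>D\<close>: \<open>\<Gamma>D = frontier \<Omega>\<close> is the Dirichlet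
  case, \<open>\<Gamma>D = {}\<close> the Neumann case, anything in between the mixed case. For vector-valued functions
  and an invertible \<open>M\<close>, prescribing the conormal derivative \<open>M \<partial>v/\<partial>\<nu>\<close> is the same as prescribing
  \<open>\<partial>v/\<partial>\<nu>\<close>.\<close>

definition same_boundary_data ::
  "(real^'d::finite) set \<Rightarrow> (real^'d) set \<Rightarrow>
   (real^'d \<Rightarrow> real^'j::finite) \<Rightarrow> (real^'d \<Rightarrow> real^'j) \<Rightarrow> bool" where
  "same_boundary_data \<Omega> \<Gamma>D v w \<longleftrightarrow> (AE x in surface_measure \<Omega>.
     if x \<in> \<Gamma>D then trace \<Omega> v x = trace \<Omega> w x else normal_trace \<Omega> v x = normal_trace \<Omega> w x)"

definition inhomogeneous_Neumann ::
  "(real^'d::finite) set \<Rightarrow> (real^'d) set \<Rightarrow> real \<Rightarrow> (real \<Rightarrow> real^'d \<Rightarrow> real^'j::finite) \<Rightarrow> bool" where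
  "inhomogeneous_Neumann \<Omega> \<Gamma>D T \<phi> \<longleftrightarrow>
     \<Gamma>D = {} \<and> (\<exists>t\<in>{0..T}. \<not> (AE x in surface_measure \<Omega>. normal_trace \<Omega> (\<phi> t) x = 0))"


section \<open>The reaction-diffusion problem\<close>

text \<open>Continuity and differentiability on \<open>[0,T]\<close> of functions with values in a space \<open>X\<close> whose norm
  is given through its square \<open>sq\<close>.\<close>

definition time_continuous ::
  "real \<Rightarrow> ('x \<Rightarrow> 'v) set \<Rightarrow> (('x \<Rightarrow> 'v) \<Rightarrow> real) \<Rightarrow> (real \<Rightarrow> 'x \<Rightarrow> 'v::real_vector) \<Rightarrow> bool" where
  "time_continuous T X sq u \<longleftrightarrow> (\<forall>t\<in>{0..T}. u t \<in> X \<and>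
     ((\<lambda>s. sq (\<lambda>x. u s x - u t x)) \<longlongrightarrow> 0) (at t within {0..T}))"

definition has_time_derivative ::
  "real \<Rightarrow> (('x \<Rightarrow> 'v) \<Rightarrow> real) \<Rightarrow> (real \<Rightarrow> 'x \<Rightarrow> 'v::real_vector) \<Rightarrow> (real \<Rightarrow> 'x \<Rightarrow> 'v) \<Rightarrow> bool" where
  "has_time_derivative T sq u u' \<longleftrightarrow> (\<forall>t\<in>{0..T}.
     ((\<lambda>s. sq (\<lambda>x. (1 / (s - t)) *\<^sub>R (u s x - u t x) - u' t x)) \<longlongrightarrow> 0) (at t within {0..T}))"

definition Cm_in ::
  "nat \<Rightarrow> real \<Rightarrow> ('x \<Rightarrow> 'v) set \<Rightarrow> (('x \<Rightarrow> 'v) \<Rightarrow> real) \<Rightarrow> (real \<Rightarrow> 'x \<Rightarrow> 'v::real_vector) \<Rightarrow> bool" where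
  "Cm_in m T X sq u \<longleftrightarrow> (\<exists>D :: nat \<Rightarrow> real \<Rightarrow> 'x \<Rightarrow> 'v. D 0 = u \<and>
     (\<forall>i\<le>m. time_continuous T X sq (D i)) \<and> (\<forall>i<m. has_time_derivative T sq (D i) (D (Suc i))))"

definition strong_solution ::
  "(real^'d::finite) set \<Rightarrow> (real^'d) set \<Rightarrow> real \<Rightarrow> real^'j::finite^'j \<Rightarrow> (real^'j \<Rightarrow> real^'j) \<Rightarrow>
   (real \<Rightarrow> real^'d \<Rightarrow> real^'j) \<Rightarrow> (real \<Rightarrow> real^'d \<Rightarrow> real^'j) \<Rightarrow> (real^'d \<Rightarrow> real^'j) \<Rightarrow>
   (real \<Rightarrow> real^'d \<Rightarrow> real^'j) \<Rightarrow> bool" where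
  "strong_solution \<Omega> \<Gamma>D T M f S \<phi> u0 u \<longleftrightarrow>
     time_continuous T (sobolev 2 \<Omega>) (sobolev_sqnorm 2 \<Omega>) u \<and>
     (\<exists>u'. time_continuous T (lsq \<Omega>) (sobolev_sqnorm 0 \<Omega>) u' \<and>
        has_time_derivative T (sobolev_sqnorm 0 \<Omega>) u u' \<and>
        (\<forall>t\<in>{0<..<T}. AE x in lebesgue_on \<Omega>.
           u' t x - M *v (\<Sum>i\<in>UNIV. wpd \<Omega> i (wpd \<Omega> i (u t)) x) + f (u t x) = S t x)) \<and>
     (\<forall>t\<in>{0..T}. same_boundary_data \<Omega> \<Gamma>D (u t) (\<phi> t)) \<and>
     (AE x in lebesgue_on \<Omega>. u 0 x = u0 x)"

definition shifted_source ::
  "real^'j::finite^'j \<Rightarrow> (real \<Rightarrow> real^'d::finite \<Rightarrow> real^'j) \<Rightarrow> (real \<Rightarrow> real^'d \<Rightarrow> real^'j) \<Rightarrow>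
   real \<Rightarrow> real^'d \<Rightarrow> real^'j" where
  "shifted_source M S \<phi> t x = S t x - vector_derivative (\<lambda>s. \<phi> s x) (at t)
     + M *v (\<Sum>i\<in>UNIV. pd i (pd i (\<phi> t)) x)"


section \<open>Difference operators and correction coefficients\<close>

definition Dplus :: "real \<Rightarrow> (real \<Rightarrow> real) \<Rightarrow> real \<Rightarrow> real" where
  "Dplus \<kappa> v t = (v (t + \<kappa>) - v t) / \<kappa>"

definition Dminus :: "real \<Rightarrow> (real \<Rightarrow> real) \<Rightarrow> real \<Rightarrow> real" where
  "Dminus \<kappa> v t = (v t - v (t - \<kappa>)) / \<kappa>"

text \<open>\<open>D\<close> and \<open>E\<close> for functions, evaluated at a midpoint \<open>t\<close>.\<close>

definition Dmid :: "real \<Rightarrow> (real \<Rightarrow> real) \<Rightarrow> real \<Rightarrow> real" where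
  "Dmid \<kappa> v t = (v (t + \<kappa> / 2) - v (t - \<kappa> / 2)) / \<kappa>"

definition Emid :: "real \<Rightarrow> (real \<Rightarrow> real) \<Rightarrow> real \<Rightarrow> real" where
  "Emid \<kappa> v t = (v (t + \<kappa> / 2) + v (t - \<kappa> / 2)) / 2"

definition correction_coeffs :: "(nat \<Rightarrow> real) \<Rightarrow> bool" where
  "correction_coeffs c \<longleftrightarrow> (\<forall>P\<ge>1. \<forall>v :: real \<Rightarrow> real. smooth_on UNIV v \<longrightarrow> (\<forall>t.
     (\<lambda>\<kappa>. deriv v t - (Dmid \<kappa> v t
        - (\<Sum>i=1..P. c (2*i+1) * \<kappa>^(2*i) * Dmid \<kappa> (((Dplus \<kappa> \<circ> Dminus \<kappa>) ^^ i) v) t)))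
       \<in> O[at_right 0](\<lambda>\<kappa>. \<kappa>^(2*P+2)) \<and>
     (\<lambda>\<kappa>. v t - (Emid \<kappa> v t
        - (\<Sum>i=1..P. c (2*i) * \<kappa>^(2*i) * ((Dplus \<kappa> \<circ> Dminus \<kappa>) ^^ i) (Emid \<kappa> v) t)))
       \<in> O[at_right 0](\<lambda>\<kappa>. \<kappa>^(2*P+2))))"

text \<open>Here \<open>t\<close> is the midpoint of \<open>[a,b]\<close> and \<open>b - a = (2 * j + 1) * \<kappa>\<close>. Homogeneity in \<open>\<kappa>\<close> forces the
  power \<open>\<kappa>^(2*i+1)\<close> next to \<open>1 / (b - a)\<close>: only so do \<open>\<kappa>\<close>-independent coefficients exist, with
  \<open>e 2 = e 3 = 9 / 8\<close> for \<open>j = 1\<close>, and this is what the starting scheme below uses.\<close>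

definition starting_coeffs :: "nat \<Rightarrow> (nat \<Rightarrow> real) \<Rightarrow> bool" where
  "starting_coeffs j e \<longleftrightarrow> (\<forall>v :: real \<Rightarrow> real. smooth_on UNIV v \<longrightarrow> (\<forall>t.
     (\<lambda>\<kappa>. let a = t - (2 * real j + 1) * \<kappa> / 2; b = t + (2 * real j + 1) * \<kappa> / 2 in
        deriv v t - ((v b - v a) / (b - a) - 1 / (b - a) *
          (\<Sum>i=1..j. e (2*i+1) * \<kappa>^(2*i+1) * Dmid \<kappa> (((Dplus \<kappa> \<circ> Dminus \<kappa>) ^^ i) v) t)))
       \<in> O[at_right 0](\<lambda>\<kappa>. \<kappa>^(2*j+2)) \<and>
     (\<lambda>\<kappa>. let a = t - (2 * real j + 1) * \<kappa> / 2; b = t + (2 * real j + 1) * \<kappa> / 2 in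
        v t - ((v a + v b) / 2
          - (\<Sum>i=1..j. e (2*i) * \<kappa>^(2*i) * ((Dplus \<kappa> \<circ> Dminus \<kappa>) ^^ i) (Emid \<kappa> v) t)))
       \<in> O[at_right 0](\<lambda>\<kappa>. \<kappa>^(2*j+2))))"

text \<open>Operators on sequences; \<open>Dseq k v n\<close> and \<open>Eseq v n\<close> stand for the values at \<open>n + 1/2\<close>.
  The truncated subtraction below is harmless: the operators with parameter \<open>j\<close> are only used at
  indices \<open>n \<ge> j\<close>.\<close>

definition Dseq :: "real \<Rightarrow> (nat \<Rightarrow> 'v::real_vector) \<Rightarrow> nat \<Rightarrow> 'v" where
  "Dseq k v n = (1 / k) *\<^sub>R (v (n + 1) - v n)"

definition Eseq :: "(nat \<Rightarrow> 'v::real_vector) \<Rightarrow> nat \<Rightarrow> 'v" where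
  "Eseq v n = (1 / 2) *\<^sub>R (v (n + 1) + v n)"

definition Lam :: "(nat \<Rightarrow> real) \<Rightarrow> nat \<Rightarrow> (nat \<Rightarrow> 'v::real_vector) \<Rightarrow> nat \<Rightarrow> 'v" where
  "Lam c j v n =
     (\<Sum>i=1..j. \<Sum>l=0..2*i. (c (2*i+1) * (-1)^l * real ((2*i) choose l)) *\<^sub>R v (n + i - l))"

definition Gam :: "(nat \<Rightarrow> real) \<Rightarrow> nat \<Rightarrow> (nat \<Rightarrow> 'v::real_vector) \<Rightarrow> nat \<Rightarrow> 'v" where
  "Gam c j v n =
     (\<Sum>i=1..j. \<Sum>l=0..2*i. (c (2*i) * (-1)^l * real ((2*i) choose l)) *\<^sub>R v (n + i - l))"

text \<open>\<open>LamD_start k e j w n\<close> and \<open>GamE_start e j w n\<close> are the terms replacing \<open>\<Lambda>\<^sup>jD\<close> and \<open>\<Gamma>\<^sup>jE\<close> at \<open>n + 1/2\<close>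
  for \<open>n < j\<close>; \<open>k\<close> is the coarse time step, \<open>w\<close> lives on the grid with step \<open>k / (2 * j + 1)\<close>.\<close>

definition LamD_start ::
  "real \<Rightarrow> (nat \<Rightarrow> real) \<Rightarrow> nat \<Rightarrow> (nat \<Rightarrow> 'v::real_vector) \<Rightarrow> nat \<Rightarrow> 'v" where
  "LamD_start k e j w n = (let m = (2*j+1)*n + j in (1 / k) *\<^sub>R
     (\<Sum>i=1..j. \<Sum>l=0..2*i+1. (e (2*i+1) * (-1)^l * real ((2*i+1) choose l)) *\<^sub>R w (m + i + 1 - l)))"

definition GamE_start :: "(nat \<Rightarrow> real) \<Rightarrow> nat \<Rightarrow> (nat \<Rightarrow> 'v::real_vector) \<Rightarrow> nat \<Rightarrow> 'v" where
  "GamE_start e j w n =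
     (let m = (2*j+1)*n + j in (1 / 2) *\<^sub>R (Gam e j w (m + 1) + Gam e j w m))"


section \<open>Finite elements\<close>

definition poly_of_degree_le_on ::
  "nat \<Rightarrow> (real^'d::finite) set \<Rightarrow> (real^'d \<Rightarrow> real^'j::finite) \<Rightarrow> bool" where
  "poly_of_degree_le_on r K g \<longleftrightarrow> (\<exists>a :: ('d \<Rightarrow> nat) \<Rightarrow> real^'j. \<forall>x\<in>K.
     g x = (\<Sum>\<alpha> | sum \<alpha> UNIV \<le> r. (\<Prod>i\<in>UNIV. (x $ i) ^ \<alpha> i) *\<^sub>R a \<alpha>))"

definition mesh :: "(real^'d::finite) set \<Rightarrow> (real^'d) set set \<Rightarrow> bool" where
  "mesh \<Omega> \<T> \<longleftrightarrow> finite \<T> \<and> \<Union>\<T> = closure \<Omega> \<and>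
     (\<forall>K\<in>\<T>. interior K \<noteq> {} \<and> K = closure (interior K)) \<and>
     (\<forall>K\<in>\<T>. \<forall>L\<in>\<T>. K \<noteq> L \<longrightarrow> interior K \<inter> interior L = {})"

definition V_space ::
  "(real^'d::finite) set \<Rightarrow> (real^'d) set \<Rightarrow> (real^'d \<Rightarrow> real^'j::finite) set" where
  "V_space \<Omega> \<Gamma>D =
     {v \<in> sobolev 1 \<Omega>. AE x in surface_measure \<Omega>. x \<in> \<Gamma>D \<longrightarrow> trace \<Omega> v x = 0}"

definition fe_fun ::
  "nat \<Rightarrow> (nat \<Rightarrow> 'x \<Rightarrow> 'v::real_vector) \<Rightarrow> (nat \<Rightarrow> real) \<Rightarrow> 'x \<Rightarrow> 'v" where
  "fe_fun Nh \<beta> U x = (\<Sum>l<Nh. U l *\<^sub>R \<beta> l x)"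

definition fe_space :: "nat \<Rightarrow> (nat \<Rightarrow> 'x \<Rightarrow> 'v::real_vector) \<Rightarrow> ('x \<Rightarrow> 'v) set" where
  "fe_space Nh \<beta> = range (fe_fun Nh \<beta>)"

definition fe_basis ::
  "(real^'d::finite) set \<Rightarrow> (real^'d) set \<Rightarrow> nat \<Rightarrow> nat \<Rightarrow> (nat \<Rightarrow> real^'d \<Rightarrow> real^'j::finite) \<Rightarrow> bool" where
  "fe_basis \<Omega> \<Gamma>D r Nh \<beta> \<longleftrightarrow>
     (\<forall>U. (\<forall>x\<in>\<Omega>. fe_fun Nh \<beta> U x = 0) \<longrightarrow> (\<forall>l<Nh. U l = 0)) \<and>
     (\<forall>l<Nh. continuous_on (closure \<Omega>) (\<beta> l)) \<and>
     (\<exists>\<T>. mesh \<Omega> \<T> \<and> (\<forall>l<Nh. \<forall>K\<in>\<T>. poly_of_degree_le_on r K (\<beta> l))) \<and>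
     fe_space Nh \<beta> \<subseteq> V_space \<Omega> \<Gamma>D"

definition grad_inner ::
  "(real^'d::finite) set \<Rightarrow> real^'j::finite^'j \<Rightarrow>
   (real^'d \<Rightarrow> real^'j) \<Rightarrow> (real^'d \<Rightarrow> real^'j) \<Rightarrow> real" where
  "grad_inner \<Omega> M v w = (\<Sum>i\<in>UNIV. l2_inner \<Omega> (\<lambda>x. M *v wpd \<Omega> i v x) (wpd \<Omega> i w))"

definition R_h ::
  "(real^'d::finite) set \<Rightarrow> real^'j::finite^'j \<Rightarrow> (real^'d \<Rightarrow> real^'j) set \<Rightarrow>
   (real^'d \<Rightarrow> real^'j) \<Rightarrow> real^'d \<Rightarrow> real^'j" where
  "R_h \<Omega> M Sh v = (THE w. w \<in> Sh \<and> (\<forall>\<psi>\<in>Sh.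
     l2_inner \<Omega> (\<lambda>x. v x - w x) \<psi> + grad_inner \<Omega> M (\<lambda>x. v x - w x) \<psi> = 0))"


section \<open>The fully discrete deferred correction schemes\<close>

text \<open>The Galerkin equation at time \<open>t\<close>, with \<open>dv\<close> in place of the time derivative and \<open>ev\<close> in place of
  the value of the unknown.\<close>

definition galerkin_eq ::
  "(real^'d::finite) set \<Rightarrow> real^'j::finite^'j \<Rightarrow> (real^'j \<Rightarrow> real^'j) \<Rightarrow>
   (real \<Rightarrow> real^'d \<Rightarrow> real^'j) \<Rightarrow> (real \<Rightarrow> real^'d \<Rightarrow> real^'j) \<Rightarrow> (real^'d \<Rightarrow> real^'j) set \<Rightarrow>
   real \<Rightarrow> (real^'d \<Rightarrow> real^'j) \<Rightarrow> (real^'d \<Rightarrow> real^'j) \<Rightarrow> bool" where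
  "galerkin_eq \<Omega> M f S \<phi> Sh t dv ev \<longleftrightarrow> (\<forall>\<psi>\<in>Sh.
     l2_inner \<Omega> dv \<psi> + grad_inner \<Omega> M ev \<psi> + l2_inner \<Omega> (\<lambda>x. f (ev x + \<phi> t x)) \<psi>
       = l2_inner \<Omega> (shifted_source M S \<phi> t) \<psi>)"

text \<open>\<open>DC_solution \<dots> j k N w\<close>: for every \<open>1 \<le> i \<le> j\<close> the sequence \<open>w i 0, \<dots>, w i N\<close> solves the scheme
  of order \<open>2 * i\<close> with time step \<open>k\<close>, with \<open>w (i - 1)\<close> as the previous stage and, for the starting
  steps, some solution of the previous stage on the grid with time step \<open>k / (2 * i - 1)\<close> of the same
  time interval. An equation is imposed at \<open>n\<close> whenever its midpoint \<open>(n + 1/2) * k\<close> and all indices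
  occurring in it stay within the grid \<open>0, \<dots>, N\<close> (in the starting steps, within the fine grid
  \<open>0, \<dots>, (2 * i - 1) * N\<close>, which is automatic). For \<open>j = 0\<close> in the second equation, \<open>Lam\<close> and \<open>Gam\<close> are
  empty sums and there is no starting step.\<close>

primrec DC_solution ::
  "(real^'d::finite) set \<Rightarrow> real^'j::finite^'j \<Rightarrow> (real^'j \<Rightarrow> real^'j) \<Rightarrow>
   (real \<Rightarrow> real^'d \<Rightarrow> real^'j) \<Rightarrow> (real \<Rightarrow> real^'d \<Rightarrow> real^'j) \<Rightarrow> (real^'d \<Rightarrow> real^'j) \<Rightarrow>
   (real^'d \<Rightarrow> real^'j) set \<Rightarrow> (nat \<Rightarrow> real) \<Rightarrow> (nat \<Rightarrow> nat \<Rightarrow> real) \<Rightarrow>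
   nat \<Rightarrow> real \<Rightarrow> nat \<Rightarrow> (nat \<Rightarrow> nat \<Rightarrow> real^'d \<Rightarrow> real^'j) \<Rightarrow> bool" where
  "DC_solution \<Omega> M f S \<phi> u0 Sh c e 0 k N w \<longleftrightarrow> True"
| "DC_solution \<Omega> M f S \<phi> u0 Sh c e (Suc j) k N w \<longleftrightarrow>
     DC_solution \<Omega> M f S \<phi> u0 Sh c e j k N w \<and>
     (\<forall>n\<le>N. w (Suc j) n \<in> Sh) \<and>
     w (Suc j) 0 = R_h \<Omega> M Sh (\<lambda>x. u0 x - \<phi> 0 x) \<and>
     (\<forall>n. j \<le> n \<and> n + j + 1 \<le> N \<longrightarrow>
        galerkin_eq \<Omega> M f S \<phi> Sh ((real n + 1/2) * k)
          (\<lambda>x. Dseq k (\<lambda>m. w (Suc j) m x) n - Lam c j (Dseq k (\<lambda>m. w j m x)) n)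
          (\<lambda>x. Eseq (\<lambda>m. w (Suc j) m x) n - Gam c j (Eseq (\<lambda>m. w j m x)) n)) \<and>
     (\<exists>z. DC_solution \<Omega> M f S \<phi> u0 Sh c e j (k / real (2*j+1)) ((2*j+1) * N) z \<and>
        (\<forall>n. n < j \<and> n + 1 \<le> N \<longrightarrow>
           galerkin_eq \<Omega> M f S \<phi> Sh ((real n + 1/2) * k)
             (\<lambda>x. Dseq k (\<lambda>m. w (Suc j) m x) n - LamD_start k (e j) j (\<lambda>m. z j m x) n)
             (\<lambda>x. Eseq (\<lambda>m. w (Suc j) m x) n - GamE_start (e j) j (\<lambda>m. z j m x) n)))"

end

theory Submission
  imports Defs
begin

text \<open>Every step of every stage asks for an element \<open>X\<close> of the finite element space. In terms of
\<open>Y = (X + w)/2 - ec\<close>, the value that enters the elliptic and the nonlinear term (\<open>w\<close> is the value at the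
previous time and \<open>ec\<close> a known correction), the equation reads
\<open>(2/k) (Y, \<psi>) + (M \<nabla>Y, \<nabla>\<psi>) + (f(Y + \<phi>), \<psi>) = F(\<psi>)\<close> for all \<open>\<psi>\<close>, with a known linear functional \<open>F\<close>. The
one-sided bound on \<open>f\<close> at the points \<open>Y + \<phi>\<close> and \<open>\<phi>\<close> gives \<open>f(Y + \<phi>) \<bullet> Y \<ge> -\<Lambda> |Y|\<^sup>2 - C |Y|\<close>, where \<open>\<Lambda>\<close>
is the supremum of \<open>|\<tau> \<circ> \<phi>|\<close>. Since \<open>k \<Lambda> < 2\<close>, the equation is coercive.

The left hand side is in general neither monotone in \<open>Y\<close> nor a gradient, so a solution is obtained
topologically: a continuous vector field on a cube that points outwards on the boundary has a zero
(\<open>zero_of_coercive_map\<close>, from Kuhn's lemma), applied to the residual as a function of the coefficients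
(\<open>nonlinear_galerkin_solvable\<close>, \<open>crank_nicolson_step_solvable\<close>).

Two points need real analysis. First, weak derivatives are arbitrary representatives, so the gradient
form is bilinear only because weak derivatives are unique almost everywhere
(\<open>AE_zero_if_orthogonal_to_test_functions\<close>, \<open>weak_partial_unique\<close>). Secondly, the projection of the initial
value is meaningful only if \<open>u\<^sub>0 - \<phi>(0)\<close> has weak derivatives; for \<open>u\<^sub>0\<close> they come from the strong
solution, for \<open>\<phi>(0)\<close> from integration by parts (\<open>weak_partial_pd\<close>).

The stages are then produced by recursion on the order. A stage also needs the previous stage on a grid
refined by an odd factor, so solvability is proved for all admissible step sizes simultaneously.\<close>

section \<open>Zeros of coercive vector fields\<close>

lemma compact_sequence_cube: "compact {U :: nat \<Rightarrow> real. \<forall>i. \<bar>U i\<bar> \<le> R}"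
proof -
  have "compactin (product_topology (\<lambda>_. euclidean) (UNIV :: nat set)) (PiE UNIV (\<lambda>_. {-R..R}))"
    by (subst compactin_PiE) simp
  moreover have "PiE UNIV (\<lambda>_. {-R..R}) = {U :: nat \<Rightarrow> real. \<forall>i. \<bar>U i\<bar> \<le> R}"
    by (auto simp: PiE_def Pi_def abs_le_iff minus_le_iff)
  ultimately show ?thesis
    by (simp add: euclidean_product_topology compactin_euclidean_iff)
qed

lemma tendsto_fun_iff:
  fixes X :: "'b \<Rightarrow> 'a \<Rightarrow> 'c::topological_space"
  shows "(X \<longlongrightarrow> x) F \<longleftrightarrow> (\<forall>i. ((\<lambda>n. X n i) \<longlongrightarrow> x i) F)"
proof -
  have "(X \<longlongrightarrow> x) F \<longleftrightarrow> limitin (product_topology (\<lambda>_. euclidean) UNIV) X x F"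
    by (simp add: euclidean_product_topology)
  also have "\<dots> \<longleftrightarrow> (\<forall>i. ((\<lambda>n. X n i) \<longlongrightarrow> x i) F)"
    by (simp add: limitin_componentwise)
  finally show ?thesis .
qed

text \<open>Colour the vertices of a fine grid of the cube, for each coordinate \<open>i\<close>, by the sign of \<open>P\<^sub>i\<close>, except
that the two faces orthogonal to \<open>i\<close> get their colour by decree. Kuhn's combinatorial lemma yields an
arbitrarily small cell which carries both colours of every coordinate, and an accumulation point of
such cells satisfies the variational inequality of \<open>P\<close> on the cube. Vectors are sequences because the
dimension \<open>n\<close> has to be a number and not a type: later it is the dimension of an arbitrary finite
element space.\<close>

lemma cube_variational_inequality:
  fixes P :: "(nat \<Rightarrow> real) \<Rightarrow> nat \<Rightarrow> real"
  assumes cont: "\<And>i. i < n \<Longrightarrow> continuous_on UNIV (\<lambda>U. P U i)" and R: "0 < R"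
  obtains U where "\<And>i. \<bar>U i\<bar> \<le> R"
    "\<And>i. i < n \<Longrightarrow> U i = -R \<or> P U i \<le> 0" "\<And>i. i < n \<Longrightarrow> U i = R \<or> 0 \<le> P U i"
proof -
  let ?low = "\<lambda>i. {U. U i = -R \<or> P U i \<le> 0}" and ?high = "\<lambda>i. {U. U i = R \<or> 0 \<le> P U i}"
  have "\<exists>Q. (\<forall>i. \<bar>Q i\<bar> \<le> R) \<and> (\<forall>i<n. \<exists>X Y. X \<in> ?low i \<and> Y \<in> ?high i \<and>
          (\<forall>j. \<bar>X j - Q j\<bar> \<le> 2 * R / Suc m) \<and> (\<forall>j. \<bar>Y j - Q j\<bar> \<le> 2 * R / Suc m))" for m
  proof -
    let ?p = "Suc m"
    \<comment> \<open>Coordinates from \<open>n\<close> on are kept at zero, which keeps the whole sequence in a compact set.\<close>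
    define g :: "(nat \<Rightarrow> nat) \<Rightarrow> nat \<Rightarrow> real" where "g = (\<lambda>y i. if i < n then -R + 2 * R * y i / ?p else 0)"
    define lab :: "(nat \<Rightarrow> nat) \<Rightarrow> nat \<Rightarrow> nat" where "lab = (\<lambda>y i. if y i = 0 then 0 else if y i = ?p then 1 else
        if P (g y) i < 0 then 0 else 1)"
    obtain q where q: "\<forall>i<n. q i < ?p" and
      lab: "\<forall>i<n. \<exists>r s. (\<forall>j<n. q j \<le> r j \<and> r j \<le> q j + 1) \<and>
        (\<forall>j<n. q j \<le> s j \<and> s j \<le> q j + 1) \<and> lab r i \<noteq> lab s i"
      by (rule kuhn_lemma[of ?p n lab]) (auto simp: lab_def)
    have low: "g y \<in> ?low i" if "lab y i = 0" "i < n" for y i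
      using that by (auto simp: lab_def g_def split: if_splits)
    have high: "g y \<in> ?high i" if "lab y i \<noteq> 0" "i < n" for y i
    proof (cases "y i = ?p")
      case True
      then show ?thesis using that by (simp add: g_def del: of_nat_Suc)
    next
      case False
      then show ?thesis using that by (auto simp: lab_def split: if_splits)
    qed
    have close: "\<bar>g y j - g q j\<bar> \<le> 2 * R / ?p" if "\<forall>j<n. q j \<le> y j \<and> y j \<le> q j + 1" for y j
    proof (cases "j < n")
      case True
      then have *: "real (y j) - real (q j) \<in> {0..1}" using that by fastforce
      have "g y j - g q j = (2 * R / ?p) * (real (y j) - real (q j))"
        using True by (simp add: g_def diff_divide_distrib algebra_simps del: of_nat_Suc)
      also have "\<bar>\<dots>\<bar> \<le> (2 * R / ?p) * 1"
        using * R by (subst abs_mult) (intro mult_mono, auto)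
      finally show ?thesis by simp
    qed (use R in \<open>simp add: g_def\<close>)
    show ?thesis
    proof (rule exI[of _ "g q"], intro conjI allI impI)
      fix i
      show "\<bar>g q i\<bar> \<le> R"
      proof (cases "i < n")
        case True
        have "0 \<le> real (q i) / ?p" "real (q i) / ?p \<le> 1" using q True by (auto simp: field_simps less_imp_le)
        then have "0 \<le> 2 * R * (real (q i) / ?p)" "2 * R * (real (q i) / ?p) \<le> 2 * R * 1"
          using R by (simp, intro mult_left_mono, auto)
        then show ?thesis using True by (simp add: g_def abs_le_iff)
      qed (use R in \<open>simp add: g_def\<close>)
    next
      fix i assume i: "i < n"
      obtain r s where rs: "\<forall>j<n. q j \<le> r j \<and> r j \<le> q j + 1" "\<forall>j<n. q j \<le> s j \<and> s j \<le> q j + 1"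
        "lab r i \<noteq> lab s i" using lab i by blast
      consider "lab r i = 0" "lab s i \<noteq> 0" | "lab s i = 0" "lab r i \<noteq> 0" using rs(3)
        by (auto simp: lab_def split: if_splits)
      then show "\<exists>X Y. X \<in> ?low i \<and> Y \<in> ?high i \<and>
          (\<forall>j. \<bar>X j - g q j\<bar> \<le> 2 * R / ?p) \<and> (\<forall>j. \<bar>Y j - g q j\<bar> \<le> 2 * R / ?p)"
      proof cases
        case 1
        then show ?thesis using low high close rs i by blast
      next
        case 2
        then show ?thesis using low high close rs i by blast
      qed
    qed
  qed
  then have "\<exists>Q. \<forall>m. (\<forall>i. \<bar>Q m i\<bar> \<le> R) \<and> (\<forall>i<n. \<exists>X Y. X \<in> ?low i \<and> Y \<in> ?high i \<and>
          (\<forall>j. \<bar>X j - Q m j\<bar> \<le> 2 * R / Suc m) \<and> (\<forall>j. \<bar>Y j - Q m j\<bar> \<le> 2 * R / Suc m))"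
    by (intro choice allI)
  then obtain Q where Q: "\<And>m i. \<bar>Q m i\<bar> \<le> R" and
    XY: "\<And>m i. i < n \<Longrightarrow> \<exists>X Y. X \<in> ?low i \<and> Y \<in> ?high i \<and>
      (\<forall>j. \<bar>X j - Q m j\<bar> \<le> 2 * R / Suc m) \<and> (\<forall>j. \<bar>Y j - Q m j\<bar> \<le> 2 * R / Suc m)"
    by blast
  have "\<exists>U\<in>{U. \<forall>i. \<bar>U i\<bar> \<le> R}. \<exists>\<sigma>. strict_mono (\<sigma> :: nat \<Rightarrow> nat) \<and> (Q \<circ> \<sigma>) \<longlonglongrightarrow> U"
    using compact_imp_seq_compact[OF compact_sequence_cube, of R] Q
    unfolding seq_compact_def by blast
  then obtain U \<sigma> where U: "\<And>i. \<bar>U i\<bar> \<le> R" and \<sigma>: "strict_mono \<sigma>" "(Q \<circ> \<sigma>) \<longlonglongrightarrow> U"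
    by blast
  have step: "(\<lambda>m. 2 * R / Suc (\<sigma> m)) \<longlonglongrightarrow> 0"
    using LIMSEQ_subseq_LIMSEQ[OF tendsto_mult_right[OF LIMSEQ_inverse_real_of_nat, of "2*R"] \<sigma>(1)]
    by (simp add: o_def divide_inverse mult.commute[of "2 * R"])
  have lim: "(\<lambda>m. X m) \<longlonglongrightarrow> U" if "\<And>m j. \<bar>X m j - Q (\<sigma> m) j\<bar> \<le> 2 * R / Suc (\<sigma> m)" for X
    unfolding tendsto_fun_iff
  proof
    fix j
    have "(\<lambda>m. X m j - Q (\<sigma> m) j) \<longlonglongrightarrow> 0"
      by (rule Lim_null_comparison[OF _ step]) (use that in simp)
    moreover have "(\<lambda>m. Q (\<sigma> m) j) \<longlonglongrightarrow> U j" using \<sigma>(2) by (simp add: tendsto_fun_iff)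
    ultimately show "(\<lambda>m. X m j) \<longlonglongrightarrow> U j" using tendsto_add by fastforce
  qed
  have coord: "continuous_on UNIV (\<lambda>U :: nat \<Rightarrow> real. U i)" for i
    by (rule continuous_on_product_coordinates)
  have closed: "closed (?low i)" "closed (?high i)" if "i < n" for i
    unfolding Collect_disj_eq using cont[OF that] coord
    by (auto intro!: closed_Un closed_Collect_eq closed_Collect_le)
  have in_limit: "U \<in> ?low i" "U \<in> ?high i" if i: "i < n" for i
  proof -
    have "\<exists>X. \<forall>m. X m \<in> ?low i \<and> (\<forall>j. \<bar>X m j - Q (\<sigma> m) j\<bar> \<le> 2 * R / Suc (\<sigma> m))"
      using XY[OF i] by (intro choice allI) blast
    then obtain X where "\<And>m. X m \<in> ?low i" "X \<longlonglongrightarrow> U" using lim by blast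
    then show "U \<in> ?low i" by (rule closed_sequentially[OF closed(1)[OF i]])
    have "\<exists>Y. \<forall>m. Y m \<in> ?high i \<and> (\<forall>j. \<bar>Y m j - Q (\<sigma> m) j\<bar> \<le> 2 * R / Suc (\<sigma> m))"
      using XY[OF i] by (intro choice allI) blast
    then obtain Y where "\<And>m. Y m \<in> ?high i" "Y \<longlonglongrightarrow> U" using lim by blast
    then show "U \<in> ?high i" by (rule closed_sequentially[OF closed(2)[OF i]])
  qed
  show ?thesis by (rule that[of U]) (use U in_limit in auto)
qed

text \<open>Every term \<open>P\<^sub>i U\<^sub>i\<close> of a solution of the variational inequality is nonpositive. If \<open>P\<close> points outwards on
the boundary of the cube, the solution therefore lies in the interior, where the inequality says that
\<open>P\<close> vanishes.\<close>

lemma zero_of_coercive_map: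
  fixes P :: "(nat \<Rightarrow> real) \<Rightarrow> nat \<Rightarrow> real"
  assumes cont: "\<And>i. i < n \<Longrightarrow> continuous_on UNIV (\<lambda>U. P U i)" and R: "0 < R"
    and coercive: "\<And>U i. (\<forall>i. \<bar>U i\<bar> \<le> R) \<Longrightarrow> i < n \<Longrightarrow> \<bar>U i\<bar> = R \<Longrightarrow> 0 < (\<Sum>l<n. P U l * U l)"
  obtains U where "\<And>i. i < n \<Longrightarrow> P U i = 0"
proof -
  obtain U where U: "\<And>i. \<bar>U i\<bar> \<le> R"
    "\<And>i. i < n \<Longrightarrow> U i = -R \<or> P U i \<le> 0" "\<And>i. i < n \<Longrightarrow> U i = R \<or> 0 \<le> P U i"
    using cube_variational_inequality[where P = P and n = n and R = R] cont R by blast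
  have "P U i * U i \<le> 0" if "i < n" for i
    using U(2,3)[OF that] R by (auto simp: mult_le_0_iff)
  then have "(\<Sum>l<n. P U l * U l) \<le> 0" by (intro sum_nonpos) auto
  then have "\<bar>U i\<bar> \<noteq> R" if "i < n" for i using coercive[of U i] U(1) that by force
  then have "P U i = 0" if "i < n" for i using U(2,3)[OF that] that R by fastforce
  then show ?thesis by (rule that)
qed

section \<open>Smooth bump functions\<close>

lemma Ck_on_imp_continuous_on: "Ck_on m S g \<Longrightarrow> continuous_on S g"
proof (cases m)
  case (Suc l)
  assume "Ck_on m S g"
  then have "\<forall>x\<in>S. g differentiable at x" using Suc by simp
  then show ?thesis
    by (meson continuous_at_imp_continuous_on differentiable_imp_continuous_within)
qed simp

lemma Ck_on_SucD: "Ck_on (Suc m) S g \<Longrightarrow> Ck_on m S g"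
proof (induction m arbitrary: g)
  case 0
  then show ?case using Ck_on_imp_continuous_on[OF 0] by simp
next
  case (Suc m)
  from Suc.prems have "\<forall>x\<in>S. g differentiable at x"
    and "\<forall>v. Ck_on (Suc m) S (\<lambda>x. frechet_derivative g (at x) v)"
    unfolding Ck_on.simps(2)[of "Suc m"] by blast+
  then show ?case using Suc.IH by simp
qed

text \<open>The two rules below replace the Frechet derivative of the definition by any family of derivatives that
is at hand, so that products and compositions can be handled by induction on the order.\<close>

lemma Ck_on_SucI:
  assumes "\<And>x. (g has_derivative G x) (at x)" and "\<And>v. Ck_on m UNIV (\<lambda>x. G x v)"
  shows "Ck_on (Suc m) UNIV g"
proof -
  have "frechet_derivative g (at x) = G x" for x
    using frechet_derivative_at[OF assms(1)] by metis
  then show ?thesis using assms by (auto simp: differentiable_def)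
qed

lemma Ck_on_SucE:
  assumes "Ck_on (Suc m) UNIV g"
  obtains G where "\<And>x. (g has_derivative G x) (at x)" and "\<And>v. Ck_on m UNIV (\<lambda>x. G x v)"
  using assms that[of "\<lambda>x. frechet_derivative g (at x)"] frechet_derivative_works by auto

lemma Ck_on_const: "Ck_on m UNIV (\<lambda>_. c)"
proof (induction m arbitrary: c)
  case (Suc m)
  show ?case by (rule Ck_on_SucI[OF has_derivative_const Suc])
qed simp

lemma Ck_on_add: "Ck_on m UNIV f \<Longrightarrow> Ck_on m UNIV g \<Longrightarrow> Ck_on m UNIV (\<lambda>x. f x + g x)"
proof (induction m arbitrary: f g)
  case (Suc m)
  from Suc.prems obtain F G where
    "\<And>x. (f has_derivative F x) (at x)" "\<And>v. Ck_on m UNIV (\<lambda>x. F x v)"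
    "\<And>x. (g has_derivative G x) (at x)" "\<And>v. Ck_on m UNIV (\<lambda>x. G x v)"
    by (metis Ck_on_SucE)
  then show ?case by (intro Ck_on_SucI[where G = "\<lambda>x v. F x v + G x v"] has_derivative_add Suc.IH)
qed (auto intro: continuous_intros)

lemma Ck_on_scaleR:
  fixes f :: "'a::real_normed_vector \<Rightarrow> real"
  shows "Ck_on m UNIV f \<Longrightarrow> Ck_on m UNIV g \<Longrightarrow> Ck_on m UNIV (\<lambda>x. f x *\<^sub>R g x)"
proof (induction m arbitrary: f g)
  case (Suc m)
  from Suc.prems obtain F G where d:
    "\<And>x. (f has_derivative F x) (at x)" "\<And>v. Ck_on m UNIV (\<lambda>x. F x v)"
    "\<And>x. (g has_derivative G x) (at x)" "\<And>v. Ck_on m UNIV (\<lambda>x. G x v)"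
    by (metis Ck_on_SucE)
  then show ?case
    by (intro Ck_on_SucI[where G = "\<lambda>x v. f x *\<^sub>R G x v + F x v *\<^sub>R g x"] has_derivative_scaleR
        Ck_on_add Suc.IH d Suc.prems[THEN Ck_on_SucD])
qed (auto intro: continuous_intros)

lemma Ck_on_mult:
  fixes f g :: "'a::real_normed_vector \<Rightarrow> real"
  shows "Ck_on m UNIV f \<Longrightarrow> Ck_on m UNIV g \<Longrightarrow> Ck_on m UNIV (\<lambda>x. f x * g x)"
  using Ck_on_scaleR[of m f g] by simp

lemma Ck_on_prod:
  fixes f :: "'i \<Rightarrow> 'a::real_normed_vector \<Rightarrow> real"
  assumes "finite I" "\<And>i. i \<in> I \<Longrightarrow> Ck_on m UNIV (f i)"
  shows "Ck_on m UNIV (\<lambda>x. \<Prod>i\<in>I. f i x)"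
  using assms
proof (induction I rule: finite_induct)
  case (insert i I)
  then show ?case using Ck_on_scaleR[of m "f i" "\<lambda>x. \<Prod>i\<in>I. f i x"] by simp
qed (simp add: Ck_on_const)

text \<open>The family of all functions \<open>p(1/t) e\<^sup>-\<^sup>1\<^sup>/\<^sup>t\<close>, extended by zero to \<open>t \<le> 0\<close>, with \<open>p\<close> a polynomial: unlike
the single function with \<open>p = 1\<close>, it is closed under differentiation, so smoothness follows by an
induction that needs first derivatives only.\<close>

definition flat :: "real poly \<Rightarrow> real \<Rightarrow> real" where
  "flat p t = (if 0 < t then poly p (1 / t) * exp (- 1 / t) else 0)"

lemma poly_times_exp_minus_tendsto_0:
  fixes p :: "real poly"
  shows "((\<lambda>s. poly p s * exp (- s)) \<longlongrightarrow> 0) at_top"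
proof -
  have "((\<lambda>s. \<Sum>i\<le>degree p. coeff p i * (s ^ i / exp s)) \<longlongrightarrow> (\<Sum>i\<le>degree p. coeff p i * 0)) at_top"
    by (intro tendsto_sum tendsto_mult tendsto_const tendsto_power_div_exp_0)
  then show ?thesis by (simp add: poly_altdef sum_distrib_right exp_minus divide_inverse mult.assoc)
qed

lemma flat_has_derivative:
  "(flat p has_real_derivative flat ([:0, 0, 1:] * (p - pderiv p)) t) (at t)"
proof -
  consider "0 < t" | "t < 0" | "t = 0" by linarith
  then show ?thesis
  proof cases
    case 1
    have "((\<lambda>t. poly p (1 / t) * exp (- 1 / t)) has_real_derivative
      flat ([:0, 0, 1:] * (p - pderiv p)) t) (at t)"
      using 1 by (auto intro!: derivative_eq_intros DERIV_chain2[OF poly_DERIV]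
        simp: flat_def algebra_simps power2_eq_square divide_simps)
    then show ?thesis
      by (rule has_field_derivative_transform_within_open[of _ _ _ "{0<..}"])
        (use 1 in \<open>auto simp: flat_def\<close>)
  next
    case 2
    have "((\<lambda>t. 0) has_real_derivative flat ([:0, 0, 1:] * (p - pderiv p)) t) (at t)"
      using 2 by (simp add: flat_def)
    then show ?thesis
      by (rule has_field_derivative_transform_within_open[of _ _ _ "{..<0}"])
        (use 2 in \<open>auto simp: flat_def\<close>)
  next
    case 3
    have "((\<lambda>h. (flat p (0 + h) - flat p 0) / h) \<longlongrightarrow> 0) (at_left 0)"
      by (rule tendsto_eventually) (auto simp: flat_def eventually_at_left_field intro!: exI[of _ "-1"])
    moreover have "((\<lambda>h. (flat p (0 + h) - flat p 0) / h) \<longlongrightarrow> 0) (at_right 0)"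
      unfolding filterlim_at_right_to_top
    proof (rule Lim_transform_eventually[OF poly_times_exp_minus_tendsto_0[of "[:0, 1:] * p"]])
      show "\<forall>\<^sub>F s in at_top. poly ([:0, 1:] * p) s * exp (- s)
          = (flat p (0 + inverse s) - flat p 0) / inverse s"
        using eventually_gt_at_top[of 0] by eventually_elim (simp add: flat_def divide_inverse)
    qed
    ultimately have "((\<lambda>h. (flat p (0 + h) - flat p 0) / h) \<longlongrightarrow> 0) (at 0)"
      by (simp add: filterlim_split_at)
    then show ?thesis using 3 by (simp add: DERIV_def flat_def)
  qed
qed

lemma Ck_on_flat_affine: "Ck_on m UNIV (\<lambda>x :: real^'d::finite. flat p (a * x $ i + b))"
proof (induction m arbitrary: p)
  case 0
  have "continuous_on UNIV (flat p)"
    by (intro continuous_at_imp_continuous_on ballI DERIV_isCont[OF flat_has_derivative])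
  then have "continuous_on UNIV (\<lambda>x :: real^'d. flat p (a * x $ i + b))"
    by (rule continuous_on_compose2) (auto intro!: continuous_intros)
  then show ?case by simp
next
  case (Suc m)
  let ?p' = "[:0, 0, 1:] * (p - pderiv p)"
  show ?case
  proof (rule Ck_on_SucI)
    fix x :: "real^'d"
    have "((\<lambda>x :: real^'d. a * x $ i + b) has_derivative (\<lambda>v. a * v $ i)) (at x)"
      by (auto intro!: derivative_eq_intros bounded_linear_imp_has_derivative[OF bounded_linear_vec_nth])
    from DERIV_compose_FDERIV[OF flat_has_derivative this]
    show "((\<lambda>x. flat p (a * x $ i + b)) has_derivative
      (\<lambda>v. flat ?p' (a * x $ i + b) *\<^sub>R (a * v $ i))) (at x)" by (simp add: mult.commute)
  next
    show "Ck_on m UNIV (\<lambda>x :: real^'d. flat ?p' (a * x $ i + b) *\<^sub>R (a * v $ i))" for v :: "real^'d"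
      by (intro Ck_on_scaleR Suc.IH Ck_on_const)
  qed
qed

text \<open>With \<open>h(t) = e\<^sup>-\<^sup>1\<^sup>/\<^sup>t\<close> for \<open>t > 0\<close> and \<open>h(t) = 0\<close> otherwise, the functions
\<open>x \<mapsto> \<Prod>\<^sub>i h(n (x\<^sub>i - a\<^sub>i)) h(n (b\<^sub>i - x\<^sub>i))\<close> are positive exactly on the open box, stay below \<open>1\<close>, and
increase to \<open>1\<close> there because \<open>h(t) \<rightarrow> 1\<close> as \<open>t \<rightarrow> \<infinity>\<close>.\<close>

lemma indicator_box_approx_test_functions:
  fixes a b :: "real^'d::finite"
  assumes "cbox a b \<subseteq> \<Omega>"
  obtains \<psi> :: "nat \<Rightarrow> real^'d \<Rightarrow> real" where "\<And>n. test_function \<Omega> (\<psi> n)"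
    "\<And>x. (\<lambda>n. \<psi> n x) \<longlonglongrightarrow> indicator (box a b) x" "\<And>n x. \<bar>\<psi> n x\<bar> \<le> 1"
proof -
  define \<psi> :: "nat \<Rightarrow> real^'d \<Rightarrow> real" where
    "\<psi> n x = (\<Prod>i\<in>UNIV. flat 1 (real (Suc n) * x $ i + - real (Suc n) * a $ i) * flat 1 (- real (Suc n) * x $ i + real (Suc n) * b $ i))"
    for n x
  have zero: "\<psi> n x = 0" if x: "x \<notin> box a b" for n x
  proof -
    from x obtain i where "x $ i \<le> a $ i \<or> b $ i \<le> x $ i"
      by (auto simp: mem_box_cart not_less)
    then have "real (Suc n) * x $ i + - real (Suc n) * a $ i \<le> 0 \<or> - real (Suc n) * x $ i + real (Suc n) * b $ i \<le> 0"
      by (simp add: mult_left_mono del: of_nat_Suc)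
    then have "flat 1 (real (Suc n) * x $ i + - real (Suc n) * a $ i) * flat 1 (- real (Suc n) * x $ i + real (Suc n) * b $ i) = 0"
      by (auto simp: flat_def)
    then show ?thesis unfolding \<psi>_def by (meson UNIV_I finite prod_zero)
  qed
  have flat1: "0 \<le> flat 1 s" "flat 1 s \<le> 1" for s by (auto simp: flat_def)
  show ?thesis
  proof
    fix n
    have "{x. \<psi> n x \<noteq> 0} \<subseteq> box a b" using zero by blast
    then have "closure {x. \<psi> n x \<noteq> 0} \<subseteq> cbox a b"
      by (meson box_subset_cbox closed_cbox closure_minimal order_trans)
    then show "test_function \<Omega> (\<psi> n)"
      unfolding test_function_def smooth_on_def
    proof (intro conjI allI)
      show "Ck_on m UNIV (\<psi> n)" for m
        unfolding \<psi>_def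
        by (intro Ck_on_prod finite Ck_on_mult Ck_on_flat_affine)
    qed (use assms bounded_subset[OF bounded_cbox] in \<open>auto simp: compact_eq_bounded_closed\<close>)
  next
    fix n x
    have "\<psi> n x \<le> 1" "0 \<le> \<psi> n x"
      unfolding \<psi>_def by (intro prod_le_1 prod_nonneg conjI mult_nonneg_nonneg mult_le_one flat1 ballI)+
    then show "\<bar>\<psi> n x\<bar> \<le> 1" by simp
  next
    fix x
    show "(\<lambda>n. \<psi> n x) \<longlonglongrightarrow> indicator (box a b) x"
    proof (cases "x \<in> box a b")
      case False
      then show ?thesis by (simp add: zero)
    next
      case True
      have lim: "(\<lambda>n. flat 1 (real (Suc n) * s)) \<longlonglongrightarrow> 1" if "0 < s" for s
      proof -
        have "(\<lambda>n. exp (- (1 / s) * inverse (real (Suc n)))) \<longlonglongrightarrow> exp (- (1 / s) * 0)"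
          by (intro tendsto_intros LIMSEQ_inverse_real_of_nat)
        then show ?thesis using that by (simp add: flat_def divide_inverse mult.commute del: of_nat_Suc)
      qed
      have "(\<lambda>n. flat 1 (real (Suc n) * x $ i + - real (Suc n) * a $ i) * flat 1 (- real (Suc n) * x $ i + real (Suc n) * b $ i)) \<longlonglongrightarrow> 1 * 1" for i
      proof (rule tendsto_mult)
        have "a $ i < x $ i" "x $ i < b $ i" using True by (auto simp: mem_box_cart)
        then show "(\<lambda>n. flat 1 (real (Suc n) * x $ i + - real (Suc n) * a $ i)) \<longlonglongrightarrow> 1"
          "(\<lambda>n. flat 1 (- real (Suc n) * x $ i + real (Suc n) * b $ i)) \<longlonglongrightarrow> 1"
          using lim[of "x $ i - a $ i"] lim[of "b $ i - x $ i"]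
          by (simp_all add: right_diff_distrib del: of_nat_Suc)
      qed
      then have "(\<lambda>n. \<psi> n x) \<longlonglongrightarrow> (\<Prod>i\<in>(UNIV::'d set). 1 * 1)"
        unfolding \<psi>_def by (intro tendsto_prod)
      then show ?thesis using True by simp
    qed
  qed
qed

section \<open>Square integrable functions and the fundamental lemma of the calculus of variations\<close>

locale bounded_open_set =
  fixes \<Omega> :: "(real^'d::finite) set"
  assumes open_domain: "open \<Omega>" and bounded_domain: "bounded \<Omega>"
begin

abbreviation "L \<equiv> lebesgue_on \<Omega>"

lemma domain_sets [simp, intro]: "\<Omega> \<in> sets lebesgue"
  using open_domain by (simp add: borel_open)

lemma domain_lmeasurable: "\<Omega> \<in> lmeasurable"
  by (rule bounded_set_imp_lmeasurable[OF bounded_domain domain_sets])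

sublocale finite_measure "lebesgue_on \<Omega>"
  using domain_lmeasurable by (rule finite_measure_lebesgue_on)

lemma integrable_inner_lsq:
  assumes "v \<in> lsq \<Omega>" "w \<in> lsq \<Omega>"
  shows "integrable L (\<lambda>x. v x \<bullet> w x)"
proof (rule Bochner_Integration.integrable_bound)
  show "integrable L (\<lambda>x. (norm (v x))\<^sup>2 + (norm (w x))\<^sup>2)"
    using assms by (auto simp: lsq_def)
  show "(\<lambda>x. v x \<bullet> w x) \<in> borel_measurable L" using assms by (auto simp: lsq_def)
  have "norm (v x \<bullet> w x) \<le> norm ((norm (v x))\<^sup>2 + (norm (w x))\<^sup>2)" for x
  proof -
    have "\<bar>v x \<bullet> w x\<bar> \<le> norm (v x) * norm (w x)" by (rule Cauchy_Schwarz_ineq2)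
    also have "\<dots> \<le> 2 * norm (v x) * norm (w x)" by simp
    also have "\<dots> \<le> (norm (v x))\<^sup>2 + (norm (w x))\<^sup>2"
      by (rule sum_squares_bound)
    finally show ?thesis by simp
  qed
  then show "AE x in L. norm (v x \<bullet> w x) \<le> norm ((norm (v x))\<^sup>2 + (norm (w x))\<^sup>2)" by simp
qed

lemma lsq_add:
  assumes "v \<in> lsq \<Omega>" "w \<in> lsq \<Omega>"
  shows "(\<lambda>x. a *\<^sub>R v x + b *\<^sub>R w x) \<in> lsq \<Omega>"
proof -
  have "integrable L (\<lambda>x. a\<^sup>2 * (v x \<bullet> v x) + 2 * a * b * (v x \<bullet> w x) + b\<^sup>2 * (w x \<bullet> w x))"
    by (intro Bochner_Integration.integrable_add integrable_mult_right integrable_inner_lsq assms)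
  also have "(\<lambda>x. a\<^sup>2 * (v x \<bullet> v x) + 2 * a * b * (v x \<bullet> w x) + b\<^sup>2 * (w x \<bullet> w x))
      = (\<lambda>x. (norm (a *\<^sub>R v x + b *\<^sub>R w x))\<^sup>2)"
    by (simp add: power2_norm_eq_inner inner_add_left inner_add_right inner_commute[of "w _" "v _"])
      (simp add: power2_eq_square algebra_simps)
  finally show ?thesis using assms by (auto simp: lsq_def)
qed

lemma lsq_imp_integrable:
  assumes "v \<in> lsq \<Omega>"
  shows "integrable L v"
proof (rule Bochner_Integration.integrable_bound)
  show "integrable L (\<lambda>x. 1 + (norm (v x))\<^sup>2)" using assms by (auto simp: lsq_def)
  have "norm (v x) \<le> norm (1 + (norm (v x))\<^sup>2)" for x
    using sum_squares_bound[of 1 "norm (v x)"] by (simp add: abs_of_nonneg)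
      (metis add_increasing2 le_add_same_cancel1 linorder_not_le mult_2 norm_ge_zero order.trans not_less)
  then show "AE x in L. norm (v x) \<le> norm (1 + (norm (v x))\<^sup>2)" by simp
qed (use assms in \<open>auto simp: lsq_def\<close>)

lemma bounded_measurable_in_lsq:
  fixes v :: "real^'d \<Rightarrow> real^'j::finite"
  assumes "v \<in> borel_measurable L" "\<And>x. x \<in> \<Omega> \<Longrightarrow> norm (v x) \<le> B"
  shows "v \<in> lsq \<Omega>"
proof -
  have "integrable L (\<lambda>x. (norm (v x))\<^sup>2)"
    by (rule integrable_const_bound[of _ "B\<^sup>2"]) (use assms in \<open>auto intro!: AE_I2 power_mono\<close>)
  then show ?thesis using assms by (simp add: lsq_def)
qed

lemma continuous_in_lsq:
  fixes v :: "real^'d \<Rightarrow> real^'j::finite"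
  assumes "continuous_on (closure \<Omega>) v"
  shows "v \<in> lsq \<Omega>"
proof -
  have "compact (v ` closure \<Omega>)"
    using assms bounded_domain by (intro compact_continuous_image) (auto simp: compact_closure)
  then obtain B where "\<And>x. x \<in> closure \<Omega> \<Longrightarrow> norm (v x) \<le> B"
    by (meson bounded_iff compact_imp_bounded image_eqI)
  moreover have "v \<in> borel_measurable L"
    by (intro continuous_imp_measurable_on_sets_lebesgue domain_sets continuous_on_subset[OF assms] closure_subset)
  ultimately show ?thesis using closure_subset by (intro bounded_measurable_in_lsq) auto
qed

lemma test_function_continuous: "test_function \<Omega> \<psi> \<Longrightarrow> continuous_on UNIV \<psi>"
  unfolding test_function_def smooth_on_def by (metis Ck_on_imp_continuous_on)

lemma bounded_compact_support:
  fixes F :: "real^'d \<Rightarrow> 'b::real_normed_vector"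
  assumes "continuous_on UNIV F" "compact K" "\<And>x. x \<notin> K \<Longrightarrow> F x = 0"
  obtains B where "\<And>x. norm (F x) \<le> B"
proof -
  have "compact (F ` K)"
    using assms by (intro compact_continuous_image) (auto intro: continuous_on_subset)
  then obtain B where "\<And>x. x \<in> K \<Longrightarrow> norm (F x) \<le> B"
    by (meson bounded_iff compact_imp_bounded image_eqI)
  then have "norm (F x) \<le> max B 0" for x using assms(3)[of x] by (cases "x \<in> K") (auto simp: le_max_iff_disj)
  then show ?thesis by (rule that)
qed

lemma integrable_scaleR_bounded_continuous:
  fixes g :: "real^'d \<Rightarrow> real^'j::finite"
  assumes g: "integrable L g" and "continuous_on UNIV \<psi>" "\<And>x. \<bar>\<psi> x\<bar> \<le> B"
  shows "integrable L (\<lambda>x. \<psi> x *\<^sub>R g x)"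
proof (rule Bochner_Integration.integrable_bound)
  show "integrable L (\<lambda>x. B *\<^sub>R g x)" using g by auto
  have "\<psi> \<in> borel_measurable L"
    using assms(2) continuous_imp_measurable_on_sets_lebesgue continuous_on_subset domain_sets by blast
  then show "(\<lambda>x. \<psi> x *\<^sub>R g x) \<in> borel_measurable L" using g by auto
  have "\<bar>\<psi> x\<bar> * norm (g x) \<le> \<bar>B\<bar> * norm (g x)" for x
    using assms(3)[of x] by (intro mult_right_mono) auto
  then show "AE x in L. norm (\<psi> x *\<^sub>R g x) \<le> norm (B *\<^sub>R g x)" by simp
qed

text \<open>The fundamental lemma. By dominated convergence \<open>g\<close> has integral zero over every closed box inside
the domain, and by the Lebesgue differentiation theorem almost every value of \<open>g\<close> is a limit of
averages over such boxes.\<close>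

lemma AE_zero_if_orthogonal_to_test_functions:
  fixes g :: "real^'d \<Rightarrow> real^'j::finite"
  assumes g: "integrable L g" and orth: "\<And>\<psi>. test_function \<Omega> \<psi> \<Longrightarrow> (LINT x|L. \<psi> x *\<^sub>R g x) = 0"
  shows "AE x in L. g x = 0"
proof -
  let ?g0 = "\<lambda>x. if x \<in> \<Omega> then g x else 0"
  have "integrable lebesgue ?g0"
    using g by (simp add: integrable_restrict_space indicator_scaleR_eq_if)
  then have "?g0 absolutely_integrable_on UNIV" by (simp add: set_integrable_def)
  then have "?g0 integrable_on cbox a b" for a b
    by (meson absolutely_integrable_on_subcbox absolutely_integrable_on_def subset_UNIV)
  from integrable_ccontinuous_explicit[OF this] obtain N where N: "negligible N" and
    diff: "\<And>x e. x \<notin> N \<Longrightarrow> 0 < e \<Longrightarrow> \<exists>d>0. \<forall>h. 0 < h \<and> h < d \<longrightarrow>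
      norm (integral (cbox x (x + h *\<^sub>R One)) ?g0 /\<^sub>R h ^ DIM(real^'d) - ?g0 x) < e" by blast
  have box: "integral (cbox a b) ?g0 = 0" if ab: "cbox a b \<subseteq> \<Omega>" for a b
  proof -
    obtain \<psi> where \<psi>: "\<And>n. test_function \<Omega> (\<psi> n)"
      "\<And>x. (\<lambda>n. \<psi> n x) \<longlonglongrightarrow> indicator (box a b) x" "\<And>n x. \<bar>\<psi> n x\<bar> \<le> 1"
      using indicator_box_approx_test_functions[OF ab] by metis
    have "(\<lambda>n. LINT x|L. \<psi> n x *\<^sub>R g x) \<longlonglongrightarrow> (LINT x|L. indicator (box a b) x *\<^sub>R g x)"
    proof (rule integral_dominated_convergence[where w = "\<lambda>x. norm (g x)"])
      show "(\<lambda>x. indicator (box a b) x *\<^sub>R g x) \<in> borel_measurable L"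
        using g by (intro borel_measurable_scaleR borel_measurable_indicator)
          (auto simp: sets_restrict_space intro!: image_eqI[of _ _ "box a b"]
            dest: box_subset_cbox[THEN subsetD] ab[THEN subsetD])
      show "(\<lambda>x. \<psi> n x *\<^sub>R g x) \<in> borel_measurable L" for n
        using integrable_scaleR_bounded_continuous[OF g test_function_continuous[OF \<psi>(1)] \<psi>(3)] by auto
      show "AE x in L. (\<lambda>n. \<psi> n x *\<^sub>R g x) \<longlonglongrightarrow> indicator (box a b) x *\<^sub>R g x"
        by (intro AE_I2 tendsto_scaleR \<psi> tendsto_const)
      show "AE x in L. norm (\<psi> n x *\<^sub>R g x) \<le> norm (g x)" for n
        using \<psi>(3)[of n] by (auto intro!: mult_left_le_one_le)
    qed (use g in auto)
    then have "(LINT x|L. indicator (box a b) x *\<^sub>R g x) = 0"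
      using orth[OF \<psi>(1)] by (simp add: LIMSEQ_const_iff)
    moreover have "indicator \<Omega> x *\<^sub>R indicator (box a b) x *\<^sub>R g x = indicator (box a b) x *\<^sub>R ?g0 x" for x
      by (auto simp: indicator_def)
    ultimately have "(LINT x:box a b|lebesgue. ?g0 x) = 0"
      by (simp add: integral_restrict_space set_lebesgue_integral_def)
    moreover have "set_integrable lebesgue (box a b) ?g0"
      using \<open>integrable lebesgue ?g0\<close> unfolding set_integrable_def
      by (intro integrable_mult_indicator) auto
    ultimately show ?thesis
      by (metis integral_open_interval set_lebesgue_integral_eq_integral(2))
  qed
  have zero: "g x = 0" if x: "x \<in> \<Omega>" "x \<notin> N" for x
  proof (rule ccontr)
    assume "g x \<noteq> 0"
    then obtain d where d: "d > 0" "\<And>h. 0 < h \<Longrightarrow> h < d \<Longrightarrow>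
      norm (integral (cbox x (x + h *\<^sub>R One)) ?g0 /\<^sub>R h ^ DIM(real^'d) - ?g0 x) < norm (g x)"
      using diff[OF x(2), of "norm (g x)"] by auto
    obtain e where e: "0 < e" "cball x e \<subseteq> \<Omega>"
      using open_domain x(1) open_contains_cball by blast
    \<comment> \<open>The diameter of a cube of side \<open>h\<close> is at most \<open>h\<close> times the dimension.\<close>
    define h where "h = min (d / 2) (e / DIM(real^'d))"
    have h: "0 < h" "h < d" "h * DIM(real^'d) \<le> e"
      using d(1) e(1) DIM_positive[where 'a = "real^'d"] by (auto simp: h_def min_def field_simps)
    have "cbox x (x + h *\<^sub>R One) \<subseteq> cball x e"
    proof
      fix y assume "y \<in> cbox x (x + h *\<^sub>R One)"
      then have "\<bar>(y - x) \<bullet> i\<bar> \<le> h" if "i \<in> Basis" for i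
        using that by (force simp: mem_box inner_diff_left inner_add_left)
      then have "norm (y - x) \<le> (\<Sum>i\<in>(Basis :: (real^'d) set). h)"
        by (intro order_trans[OF norm_le_l1] sum_mono)
      then show "y \<in> cball x e" using h(3) by (simp add: dist_norm norm_minus_commute mult.commute)
    qed
    then show False using d(2)[OF h(1,2)] box e(2) x(1) by (simp add: subset_trans)
  qed
  have "AE x in lebesgue. x \<notin> N" using N by (simp add: AE_not_in negligible_iff_null_sets)
  then show ?thesis using zero by (auto simp: AE_restrict_space_iff elim: AE_mp)
qed

section \<open>Weak derivatives and the gradient form\<close>

lemma Ck_on_pd: "Ck_on (Suc m) UNIV g \<Longrightarrow> Ck_on m UNIV (pd i g)" for g :: "real^'d \<Rightarrow> 'b::real_normed_vector"
  unfolding pd_def by simp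

lemma derivative_zero_outside_support:
  assumes "closed K" "\<And>x. x \<notin> K \<Longrightarrow> F x = 0" "x \<notin> K"
  shows "(F has_derivative (\<lambda>_. 0)) (at x)"
  by (rule has_derivative_transform_within_open[of "\<lambda>_. 0" _ _ _ "- K"])
    (use assms in \<open>auto simp: has_derivative_const\<close>)

lemma test_functionE:
  assumes "test_function \<Omega> \<psi>"
  obtains K where "compact K" "K \<subseteq> \<Omega>" "\<And>x. x \<notin> K \<Longrightarrow> \<psi> x = 0" "\<And>i x. x \<notin> K \<Longrightarrow> pd i \<psi> x = 0"
    "\<And>m. Ck_on m UNIV \<psi>" "continuous_on UNIV \<psi>" "\<And>i. continuous_on UNIV (pd i \<psi>)"
proof
  let ?K = "closure {x. \<psi> x \<noteq> 0}"
  show "compact ?K" "?K \<subseteq> \<Omega>" and Ck: "\<And>m. Ck_on m UNIV \<psi>"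
    using assms by (auto simp: test_function_def smooth_on_def)
  show K: "\<psi> x = 0" if "x \<notin> ?K" for x
    using that closure_subset[of "{x. \<psi> x \<noteq> 0}"] by auto
  show "continuous_on UNIV \<psi>" by (rule Ck_on_imp_continuous_on[OF Ck])
  show "continuous_on UNIV (pd i \<psi>)" for i by (rule Ck_on_imp_continuous_on[OF Ck_on_pd[OF Ck]])
  show "pd i \<psi> x = 0" if "x \<notin> ?K" for i x
    using frechet_derivative_at[OF derivative_zero_outside_support[OF closed_closure K that], symmetric]
    by (simp add: pd_def)
qed

lemma integrable_test_function_scaleR:
  fixes g :: "real^'d \<Rightarrow> real^'j::finite"
  assumes "test_function \<Omega> \<psi>" "g \<in> lsq \<Omega>"
  shows "integrable L (\<lambda>x. \<psi> x *\<^sub>R g x)" "integrable L (\<lambda>x. pd i \<psi> x *\<^sub>R g x)"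
proof -
  from assms(1) obtain K where K: "compact K" "\<And>x. x \<notin> K \<Longrightarrow> \<psi> x = 0" "\<And>x. x \<notin> K \<Longrightarrow> pd i \<psi> x = 0"
    and cont: "continuous_on UNIV \<psi>" "continuous_on UNIV (pd i \<psi>)" by (metis test_functionE)
  obtain B C where "\<And>x. norm (\<psi> x) \<le> B" "\<And>x. norm (pd i \<psi> x) \<le> C"
    using bounded_compact_support[OF cont(1) K(1,2)] bounded_compact_support[OF cont(2) K(1,3)] by metis
  then have BC: "\<And>x. \<bar>\<psi> x\<bar> \<le> B" "\<And>x. \<bar>pd i \<psi> x\<bar> \<le> C" by simp_all
  show "integrable L (\<lambda>x. \<psi> x *\<^sub>R g x)"
    by (rule integrable_scaleR_bounded_continuous[OF lsq_imp_integrable[OF assms(2)] cont(1) BC(1)])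
  show "integrable L (\<lambda>x. pd i \<psi> x *\<^sub>R g x)"
    by (rule integrable_scaleR_bounded_continuous[OF lsq_imp_integrable[OF assms(2)] cont(2) BC(2)])
qed

text \<open>This is what makes the gradient form meaningful: \<^const>\<open>wpd\<close> picks an arbitrary weak derivative of each
function separately, and only uniqueness relates the choices made for \<open>v\<close>, \<open>w\<close> and \<open>a v + b w\<close>.\<close>

lemma weak_partial_unique:
  assumes "weak_partial \<Omega> i v g" "weak_partial \<Omega> i v h" "g \<in> lsq \<Omega>" "h \<in> lsq \<Omega>"
  shows "AE x in L. g x = h x"
proof -
  have "AE x in L. g x - h x = 0"
  proof (rule AE_zero_if_orthogonal_to_test_functions)
    show "integrable L (\<lambda>x. g x - h x)" using assms lsq_imp_integrable by auto
    fix \<psi> assume \<psi>: "test_function \<Omega> \<psi>"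
    have "- (LINT x|L. \<psi> x *\<^sub>R g x) = - (LINT x|L. \<psi> x *\<^sub>R h x)"
      using assms(1,2)[unfolded weak_partial_def, rule_format, OF \<psi>] by simp
    then show "(LINT x|L. \<psi> x *\<^sub>R (g x - h x)) = 0"
      using integrable_test_function_scaleR(1)[OF \<psi> assms(3)] integrable_test_function_scaleR(1)[OF \<psi> assms(4)]
      by (simp add: scaleR_diff_right)
  qed
  then show ?thesis by simp
qed

lemma weak_partial_lin:
  assumes "weak_partial \<Omega> i v g" "weak_partial \<Omega> i w h"
    and lsq: "v \<in> lsq \<Omega>" "w \<in> lsq \<Omega>" "g \<in> lsq \<Omega>" "h \<in> lsq \<Omega>"
  shows "weak_partial \<Omega> i (\<lambda>x. a *\<^sub>R v x + b *\<^sub>R w x) (\<lambda>x. a *\<^sub>R g x + b *\<^sub>R h x)"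
  unfolding weak_partial_def
proof (intro allI impI)
  fix \<psi> assume \<psi>: "test_function \<Omega> \<psi>"
  have lin: "(LINT x|L. \<eta> x *\<^sub>R (a *\<^sub>R F x + b *\<^sub>R G x)) = a *\<^sub>R (LINT x|L. \<eta> x *\<^sub>R F x) + b *\<^sub>R (LINT x|L. \<eta> x *\<^sub>R G x)"
    if "integrable L (\<lambda>x. \<eta> x *\<^sub>R F x)" "integrable L (\<lambda>x. \<eta> x *\<^sub>R G x)"
    for \<eta> :: "real^'d \<Rightarrow> real" and F G :: "real^'d \<Rightarrow> real^'b"
  proof -
    have "(\<lambda>x. \<eta> x *\<^sub>R (a *\<^sub>R F x + b *\<^sub>R G x)) = (\<lambda>x. a *\<^sub>R (\<eta> x *\<^sub>R F x) + b *\<^sub>R (\<eta> x *\<^sub>R G x))"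
      by (simp add: scaleR_add_right mult.commute)
    then show ?thesis using that by (simp del: scaleR_scaleR)
  qed
  show "(LINT x|L. pd i \<psi> x *\<^sub>R (a *\<^sub>R v x + b *\<^sub>R w x)) = - (LINT x|L. \<psi> x *\<^sub>R (a *\<^sub>R g x + b *\<^sub>R h x))"
    unfolding lin[OF integrable_test_function_scaleR(1)[OF \<psi> lsq(3)] integrable_test_function_scaleR(1)[OF \<psi> lsq(4)]]
      lin[OF integrable_test_function_scaleR(2)[OF \<psi> lsq(1)] integrable_test_function_scaleR(2)[OF \<psi> lsq(2)]]
      assms(1,2)[unfolded weak_partial_def, rule_format, OF \<psi>]
    by (simp only: scaleR_minus_right minus_add_distrib)
qed

lemma sobolev_1_iff: "v \<in> sobolev 1 \<Omega> \<longleftrightarrow> v \<in> lsq \<Omega> \<and> (\<forall>i. \<exists>g\<in>lsq \<Omega>. weak_partial \<Omega> i v g)"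
  by simp

lemma sobolev_1_lsq: "v \<in> sobolev 1 \<Omega> \<Longrightarrow> v \<in> lsq \<Omega>"
  by (simp add: sobolev_1_iff)

lemma
  assumes "v \<in> sobolev 1 \<Omega>"
  shows wpd_lsq: "wpd \<Omega> i v \<in> lsq \<Omega>" and weak_partial_wpd: "weak_partial \<Omega> i v (wpd \<Omega> i v)"
proof -
  have "\<exists>g. g \<in> lsq \<Omega> \<and> weak_partial \<Omega> i v g" using assms unfolding sobolev_1_iff by blast
  from someI_ex[OF this] show "wpd \<Omega> i v \<in> lsq \<Omega>" "weak_partial \<Omega> i v (wpd \<Omega> i v)"
    unfolding wpd_def by blast+
qed

lemma sobolev_1_lin:
  assumes "v \<in> sobolev 1 \<Omega>" "w \<in> sobolev 1 \<Omega>"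
  shows "(\<lambda>x. a *\<^sub>R v x + b *\<^sub>R w x) \<in> sobolev 1 \<Omega>"
  unfolding sobolev_1_iff
proof (intro conjI allI bexI)
  show "(\<lambda>x. a *\<^sub>R v x + b *\<^sub>R w x) \<in> lsq \<Omega>" by (intro lsq_add sobolev_1_lsq assms)
  show "(\<lambda>x. a *\<^sub>R wpd \<Omega> i v x + b *\<^sub>R wpd \<Omega> i w x) \<in> lsq \<Omega>" for i by (intro lsq_add wpd_lsq assms)
  show "weak_partial \<Omega> i (\<lambda>x. a *\<^sub>R v x + b *\<^sub>R w x) (\<lambda>x. a *\<^sub>R wpd \<Omega> i v x + b *\<^sub>R wpd \<Omega> i w x)" for i
    by (intro weak_partial_lin weak_partial_wpd wpd_lsq sobolev_1_lsq assms)
qed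

lemma wpd_lin:
  assumes "v \<in> sobolev 1 \<Omega>" "w \<in> sobolev 1 \<Omega>"
  shows "AE x in L. wpd \<Omega> i (\<lambda>x. a *\<^sub>R v x + b *\<^sub>R w x) x = a *\<^sub>R wpd \<Omega> i v x + b *\<^sub>R wpd \<Omega> i w x"
  using assms
  by (intro weak_partial_unique[of i "\<lambda>x. a *\<^sub>R v x + b *\<^sub>R w x"] weak_partial_wpd weak_partial_lin sobolev_1_lin
      wpd_lsq lsq_add sobolev_1_lsq)

lemma l2_inner_commute: "l2_inner \<Omega> v w = l2_inner \<Omega> w v"
  by (simp add: l2_inner_def inner_commute)

lemma l2_inner_lin_left:
  assumes "v \<in> lsq \<Omega>" "w \<in> lsq \<Omega>" "z \<in> lsq \<Omega>"
  shows "l2_inner \<Omega> (\<lambda>x. a *\<^sub>R v x + b *\<^sub>R w x) z = a * l2_inner \<Omega> v z + b * l2_inner \<Omega> w z"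
  using assms by (simp add: l2_inner_def inner_add_left integrable_inner_lsq)

lemma l2_inner_lin_right:
  assumes "v \<in> lsq \<Omega>" "w \<in> lsq \<Omega>" "z \<in> lsq \<Omega>"
  shows "l2_inner \<Omega> z (\<lambda>x. a *\<^sub>R v x + b *\<^sub>R w x) = a * l2_inner \<Omega> z v + b * l2_inner \<Omega> z w"
  using l2_inner_lin_left[OF assms] by (simp add: l2_inner_commute)

lemma l2_inner_cong_AE:
  assumes "v \<in> lsq \<Omega>" "v' \<in> lsq \<Omega>" "w \<in> lsq \<Omega>" "w' \<in> lsq \<Omega>"
    "AE x in L. v x = v' x" "AE x in L. w x = w' x"
  shows "l2_inner \<Omega> v w = l2_inner \<Omega> v' w'"
  unfolding l2_inner_def
  by (rule integral_cong_AE) (use assms in \<open>auto simp: lsq_def\<close>)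

lemma matrix_image_lsq:
  fixes M :: "real^'j::finite^'j"
  assumes "v \<in> lsq \<Omega>"
  shows "(\<lambda>x. M *v v x) \<in> lsq \<Omega>"
proof -
  have meas: "(\<lambda>x. M *v v x) \<in> borel_measurable L"
    using assms unfolding lsq_def
    by (auto intro: borel_measurable_continuous_on[OF linear_continuous_on[OF matrix_vector_mul_bounded_linear]])
  obtain B where B: "\<And>y. norm (M *v y) \<le> norm y * B"
    using bounded_linear.bounded[OF matrix_vector_mul_bounded_linear] by blast
  have "integrable L (\<lambda>x. (norm (M *v v x))\<^sup>2)"
  proof (rule Bochner_Integration.integrable_bound)
    show "integrable L (\<lambda>x. (norm (v x))\<^sup>2 * B\<^sup>2)" using assms by (auto simp: lsq_def)
    show "AE x in L. norm ((norm (M *v v x))\<^sup>2) \<le> norm ((norm (v x))\<^sup>2 * B\<^sup>2)"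
    proof (intro AE_I2)
      fix x
      show "norm ((norm (M *v v x))\<^sup>2) \<le> norm ((norm (v x))\<^sup>2 * B\<^sup>2)"
        using power_mono[OF B[of "v x"] norm_ge_zero, of 2] by (simp add: power_mult_distrib)
    qed
  qed (use meas in simp)
  then show ?thesis using meas by (simp add: lsq_def)
qed

lemma grad_inner_lin_left:
  assumes "v \<in> sobolev 1 \<Omega>" "w \<in> sobolev 1 \<Omega>" "z \<in> sobolev 1 \<Omega>"
  shows "grad_inner \<Omega> M (\<lambda>x. a *\<^sub>R v x + b *\<^sub>R w x) z = a * grad_inner \<Omega> M v z + b * grad_inner \<Omega> M w z"
proof -
  have "l2_inner \<Omega> (\<lambda>x. M *v wpd \<Omega> i (\<lambda>x. a *\<^sub>R v x + b *\<^sub>R w x) x) (wpd \<Omega> i z)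
      = a * l2_inner \<Omega> (\<lambda>x. M *v wpd \<Omega> i v x) (wpd \<Omega> i z) + b * l2_inner \<Omega> (\<lambda>x. M *v wpd \<Omega> i w x) (wpd \<Omega> i z)" for i
  proof -
    have "l2_inner \<Omega> (\<lambda>x. M *v wpd \<Omega> i (\<lambda>x. a *\<^sub>R v x + b *\<^sub>R w x) x) (wpd \<Omega> i z)
      = l2_inner \<Omega> (\<lambda>x. a *\<^sub>R (M *v wpd \<Omega> i v x) + b *\<^sub>R (M *v wpd \<Omega> i w x)) (wpd \<Omega> i z)"
      using wpd_lin[OF assms(1,2), of i a b]
      by (intro l2_inner_cong_AE lsq_add matrix_image_lsq wpd_lsq sobolev_1_lin assms)
        (auto simp: matrix_vector_right_distrib matrix_vector_mult_scaleR elim: AE_mp)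
    also have "\<dots> = a * l2_inner \<Omega> (\<lambda>x. M *v wpd \<Omega> i v x) (wpd \<Omega> i z) + b * l2_inner \<Omega> (\<lambda>x. M *v wpd \<Omega> i w x) (wpd \<Omega> i z)"
      by (intro l2_inner_lin_left matrix_image_lsq wpd_lsq assms)
    finally show ?thesis .
  qed
  then show ?thesis by (simp add: grad_inner_def sum.distrib sum_distrib_left)
qed

lemma grad_inner_lin_right:
  assumes "v \<in> sobolev 1 \<Omega>" "w \<in> sobolev 1 \<Omega>" "z \<in> sobolev 1 \<Omega>"
  shows "grad_inner \<Omega> M z (\<lambda>x. a *\<^sub>R v x + b *\<^sub>R w x) = a * grad_inner \<Omega> M z v + b * grad_inner \<Omega> M z w"
proof -
  have "l2_inner \<Omega> (\<lambda>x. M *v wpd \<Omega> i z x) (wpd \<Omega> i (\<lambda>x. a *\<^sub>R v x + b *\<^sub>R w x))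
      = a * l2_inner \<Omega> (\<lambda>x. M *v wpd \<Omega> i z x) (wpd \<Omega> i v) + b * l2_inner \<Omega> (\<lambda>x. M *v wpd \<Omega> i z x) (wpd \<Omega> i w)" for i
  proof -
    have "l2_inner \<Omega> (\<lambda>x. M *v wpd \<Omega> i z x) (wpd \<Omega> i (\<lambda>x. a *\<^sub>R v x + b *\<^sub>R w x))
      = l2_inner \<Omega> (\<lambda>x. M *v wpd \<Omega> i z x) (\<lambda>x. a *\<^sub>R wpd \<Omega> i v x + b *\<^sub>R wpd \<Omega> i w x)"
      using wpd_lin[OF assms(1,2), of i a b]
      by (intro l2_inner_cong_AE lsq_add matrix_image_lsq wpd_lsq sobolev_1_lin assms) auto
    also have "\<dots> = a * l2_inner \<Omega> (\<lambda>x. M *v wpd \<Omega> i z x) (wpd \<Omega> i v) + b * l2_inner \<Omega> (\<lambda>x. M *v wpd \<Omega> i z x) (wpd \<Omega> i w)"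
      by (intro l2_inner_lin_right matrix_image_lsq wpd_lsq assms)
    finally show ?thesis .
  qed
  then show ?thesis by (simp add: grad_inner_def sum.distrib sum_distrib_left)
qed

lemma grad_inner_nonneg:
  fixes M :: "real^'j::finite^'j"
  assumes "\<forall>y. y \<noteq> 0 \<longrightarrow> 0 < (M *v y) \<bullet> y"
  shows "0 \<le> grad_inner \<Omega> M v v"
proof -
  have "0 \<le> (M *v y) \<bullet> y" for y using assms by (cases "y = 0") (auto simp: less_imp_le)
  then show ?thesis
    unfolding grad_inner_def l2_inner_def by (intro sum_nonneg Bochner_Integration.integral_nonneg)
qed

text \<open>Instead of Fubini's theorem, this uses the translation invariance of Lebesgue measure: each difference
quotient of \<open>F\<close> in the direction \<open>e\<close> has integral zero. The quotients are bounded and vanish outside a common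
compact set, so their integrals converge to the integral of the derivative.\<close>

lemma integral_directional_derivative_zero:
  fixes F :: "real^'d \<Rightarrow> real^'j::finite"
  assumes deriv: "\<And>x. (F has_derivative G x) (at x)" and cont: "continuous_on UNIV (\<lambda>x. G x e)"
    and K: "compact K" "\<And>x. x \<notin> K \<Longrightarrow> F x = 0"
  shows "(LINT x|lborel. G x e) = 0"
proof -
  have "G x e = 0" if "x \<notin> K" for x
    using has_derivative_unique[OF deriv derivative_zero_outside_support[OF compact_imp_closed[OF K(1)] K(2) that]]
    by simp
  then obtain B where B: "\<And>x. norm (G x e) \<le> B"
    using bounded_compact_support[OF cont K(1)] by blast
  have contF: "continuous_on UNIV F"
    using deriv by (meson continuous_at_imp_continuous_on has_derivative_continuous)
  have "integrable lborel (\<lambda>x. indicator K x *\<^sub>R F x)"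
    by (rule borel_integrable_compact[OF K(1) continuous_on_subset[OF contF]]) simp
  moreover have "(\<lambda>x. indicator K x *\<^sub>R F x) = F" using K(2) by (auto simp: indicator_def)
  ultimately have intF: "integrable lborel F" by simp
  have shift: "integrable lborel (\<lambda>x. F (c + x))" "(LINT x|lborel. F (c + x)) = (LINT x|lborel. F x)" for c
    using integrable_distr_eq[of "(+) c" lborel borel F] integral_distr[of "(+) c" lborel borel F] intF
    by (simp_all add: lborel_distr_plus borel_measurable_integrable)
  define s where "s n = inverse (real (Suc n))" for n
  have s: "0 < s n" "s n \<le> 1" for n by (auto simp: s_def field_simps)
  define Q where "Q n x = inverse (s n) *\<^sub>R (F (s n *\<^sub>R e + x) - F x)" for n x
  \<comment> \<open>All steps \<open>s n\<close> are at most one, so \<open>K'\<close> contains the supports of all quotients.\<close>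
  define K' where "K' = (\<lambda>(x, t). x - t *\<^sub>R e) ` (K \<times> {0..1::real})"
  have "compact K'" unfolding K'_def
    by (intro compact_continuous_image compact_Times K compact_Icc)
      (auto intro!: continuous_intros simp: case_prod_beta)
  have QK': "Q n x = 0" if "x \<notin> K'" for n x
  proof -
    have "x \<notin> K"
    proof
      assume "x \<in> K"
      then have "(\<lambda>(x, t). x - t *\<^sub>R e) (x, 0) \<in> K'"
        unfolding K'_def by (intro imageI) auto
      then show False using that by simp
    qed
    moreover have "s n *\<^sub>R e + x \<notin> K"
    proof
      assume "s n *\<^sub>R e + x \<in> K"
      then have "(\<lambda>(x, t). x - t *\<^sub>R e) (s n *\<^sub>R e + x, s n) \<in> K'"
        unfolding K'_def using s[of n] by (intro imageI) auto
      then show False using that by simp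
    qed
    ultimately show ?thesis using K(2) by (simp add: Q_def)
  qed
  have Qbound: "norm (Q n x) \<le> B" for n x
  proof -
    have "norm (F (x + s n *\<^sub>R e) - F (x + 0 *\<^sub>R e)) \<le> B * norm (s n - 0)"
    proof (rule differentiable_bound[where S = UNIV and f = "\<lambda>t. F (x + t *\<^sub>R e)" and f' = "\<lambda>t h. h *\<^sub>R G (x + t *\<^sub>R e) e"])
      fix t :: real
      have "((\<lambda>t. F (x + t *\<^sub>R e)) has_derivative (\<lambda>h. G (x + t *\<^sub>R e) (h *\<^sub>R e))) (at t)"
        by (rule has_derivative_compose[OF _ deriv]) (auto intro!: derivative_eq_intros)
      then show "((\<lambda>t. F (x + t *\<^sub>R e)) has_derivative (\<lambda>h. h *\<^sub>R G (x + t *\<^sub>R e) e)) (at t)"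
        by (simp add: linear_cmul[OF has_derivative_linear[OF deriv]])
      show "onorm (\<lambda>h. h *\<^sub>R G (x + t *\<^sub>R e) e) \<le> B"
        by (rule onorm_le) (metis B mult.commute mult_left_mono norm_ge_zero norm_scaleR real_norm_def)
    qed auto
    then show ?thesis using s[of n] by (simp add: Q_def add.commute divide_simps)
  qed
  have lim: "(\<lambda>n. Q n x) \<longlonglongrightarrow> G x e" for x
  proof -
    have "((\<lambda>t. F (x + t *\<^sub>R e)) has_derivative (\<lambda>h. G (x + 0 *\<^sub>R e) (h *\<^sub>R e))) (at 0)"
      by (rule has_derivative_compose[OF _ deriv]) (auto intro!: derivative_eq_intros)
    then have "((\<lambda>t. F (x + t *\<^sub>R e)) has_derivative (\<lambda>h. h *\<^sub>R G x e)) (at 0)"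
      by (simp add: linear_cmul[OF has_derivative_linear[OF deriv]])
    then have "((\<lambda>t. norm (F (x + t *\<^sub>R e) - F x - t *\<^sub>R G x e) / norm t) \<longlongrightarrow> 0) (at 0)"
      by (simp add: has_derivative_iff_norm)
    moreover have "\<forall>\<^sub>F t in at 0. norm (F (x + t *\<^sub>R e) - F x - t *\<^sub>R G x e) / norm t
        = norm ((F (x + t *\<^sub>R e) - F x) /\<^sub>R t - G x e)"
    proof (intro eventually_at_filter[THEN iffD2] always_eventually allI impI)
      fix t :: real assume "t \<noteq> 0"
      then have "(F (x + t *\<^sub>R e) - F x) /\<^sub>R t - G x e = (F (x + t *\<^sub>R e) - F x - t *\<^sub>R G x e) /\<^sub>R t"
        by (simp add: scaleR_diff_right)
      then show "norm (F (x + t *\<^sub>R e) - F x - t *\<^sub>R G x e) / norm t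
          = norm ((F (x + t *\<^sub>R e) - F x) /\<^sub>R t - G x e)" by (simp add: divide_inverse mult.commute)
    qed
    ultimately have "((\<lambda>t. norm ((F (x + t *\<^sub>R e) - F x) /\<^sub>R t - G x e)) \<longlongrightarrow> 0) (at 0)"
      by (rule Lim_transform_eventually)
    then have "((\<lambda>t. (F (x + t *\<^sub>R e) - F x) /\<^sub>R t) \<longlongrightarrow> G x e) (at 0)"
      by (simp add: tendsto_norm_zero_iff LIM_zero_iff)
    moreover have "filterlim s (at 0) sequentially"
      using LIMSEQ_inverse_real_of_nat s unfolding filterlim_at s_def by (auto simp: less_imp_neq[symmetric])
    ultimately have "(\<lambda>n. (F (x + s n *\<^sub>R e) - F x) /\<^sub>R s n) \<longlonglongrightarrow> G x e"
      by (rule filterlim_compose)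
    then show ?thesis by (simp add: Q_def add.commute)
  qed
  have "(\<lambda>n. LINT x|lborel. Q n x) \<longlonglongrightarrow> (LINT x|lborel. G x e)"
  proof (rule integral_dominated_convergence[where w = "\<lambda>x. indicator K' x *\<^sub>R B"])
    show "(\<lambda>x. G x e) \<in> borel_measurable lborel" using cont by (simp add: borel_measurable_continuous_onI)
    show "Q n \<in> borel_measurable lborel" for n
      unfolding Q_def using shift(1) intF by auto
    show "integrable lborel (\<lambda>x. indicator K' x *\<^sub>R B)"
      by (rule borel_integrable_compact[OF \<open>compact K'\<close>]) simp
    show "AE x in lborel. norm (Q n x) \<le> indicator K' x *\<^sub>R B" for n
      using Qbound QK' by (intro AE_I2) (simp add: indicator_def)
  qed (use lim in auto)
  moreover have "(LINT x|lborel. Q n x) = 0" for n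
    unfolding Q_def using shift intF by simp
  ultimately show ?thesis by (simp add: LIMSEQ_const_iff)
qed

text \<open>Integration by parts: the preceding lemma applied to \<open>\<psi> H\<close>, which has compact support in the domain
although \<open>H\<close> need not vanish anywhere.\<close>

lemma weak_partial_pd:
  fixes H :: "real^'d \<Rightarrow> real^'j::finite"
  assumes H: "Ck_on 1 UNIV H"
  shows "weak_partial \<Omega> i H (pd i H)"
  unfolding weak_partial_def
proof (intro allI impI)
  fix \<psi> assume \<psi>: "test_function \<Omega> \<psi>"
  then obtain K where K: "compact K" "K \<subseteq> \<Omega>" "\<And>x. x \<notin> K \<Longrightarrow> \<psi> x = 0" "\<And>i x. x \<notin> K \<Longrightarrow> pd i \<psi> x = 0"
    and \<psi>1: "Ck_on 1 UNIV \<psi>" and cont: "continuous_on UNIV \<psi>" "\<And>i. continuous_on UNIV (pd i \<psi>)" by (metis test_functionE)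
  have contH: "continuous_on UNIV H" "continuous_on UNIV (pd i H)"
    using Ck_on_imp_continuous_on[OF H] Ck_on_imp_continuous_on[OF Ck_on_pd[of 0 H i]] H by simp_all
  have lsq: "H \<in> lsq \<Omega>" "pd i H \<in> lsq \<Omega>" by (intro continuous_in_lsq continuous_on_subset[OF contH(1)] continuous_on_subset[OF contH(2)], simp)+
  let ?G = "\<lambda>x v. \<psi> x *\<^sub>R frechet_derivative H (at x) v + frechet_derivative \<psi> (at x) v *\<^sub>R H x"
  have "(LINT x|lborel. ?G x (axis i 1)) = 0"
  proof (rule integral_directional_derivative_zero[OF _ _ K(1)])
    show "((\<lambda>x. \<psi> x *\<^sub>R H x) has_derivative ?G x) (at x)" for x
      using H \<psi>1 by (intro has_derivative_scaleR) (simp_all add: frechet_derivative_works)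
    show "continuous_on UNIV (\<lambda>x. ?G x (axis i 1))"
      using cont contH by (auto simp: pd_def[symmetric] intro!: continuous_intros)
  qed (use K in auto)
  moreover have "?G x (axis i 1) = indicator \<Omega> x *\<^sub>R (\<psi> x *\<^sub>R pd i H x + pd i \<psi> x *\<^sub>R H x)" for x
  proof (cases "x \<in> \<Omega>")
    case False
    then have "x \<notin> K" using K(2) by blast
    then show ?thesis using K(3,4) False by (simp add: pd_def[symmetric])
  qed (simp add: pd_def[symmetric])
  moreover have "(\<lambda>x. ?G x (axis i 1)) \<in> borel_measurable lborel"
    using cont contH by (auto simp: pd_def[symmetric] intro!: borel_measurable_continuous_onI continuous_intros)
  ultimately have "(LINT x|L. \<psi> x *\<^sub>R pd i H x + pd i \<psi> x *\<^sub>R H x) = 0"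
    by (simp add: integral_restrict_space integral_completion)
  then have "(LINT x|L. \<psi> x *\<^sub>R pd i H x) + (LINT x|L. pd i \<psi> x *\<^sub>R H x) = 0"
    using integrable_test_function_scaleR(1)[OF \<psi> lsq(2)] integrable_test_function_scaleR(2)[OF \<psi> lsq(1)] by simp
  then show "(LINT x|L. pd i \<psi> x *\<^sub>R H x) = - (LINT x|L. \<psi> x *\<^sub>R pd i H x)"
    by (simp add: eq_neg_iff_add_eq_0 add.commute)
qed

lemma Ck_in_sobolev_1:
  fixes H :: "real^'d \<Rightarrow> real^'j::finite"
  assumes "Ck_on 1 UNIV H"
  shows "H \<in> sobolev 1 \<Omega>"
proof -
  have "continuous_on UNIV H" "\<And>i. continuous_on UNIV (pd i H)"
    using Ck_on_imp_continuous_on[OF assms] Ck_on_imp_continuous_on[OF Ck_on_pd[of 0 H]] assms by simp_all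
  then have "H \<in> lsq \<Omega>" "\<And>i. pd i H \<in> lsq \<Omega>" by (meson continuous_in_lsq continuous_on_subset subset_UNIV)+
  then show ?thesis using weak_partial_pd[OF assms] unfolding sobolev_1_iff by blast
qed

text \<open>Measurability passes to almost everywhere equal functions because Lebesgue measure is complete.\<close>

lemma lsq_cong_AE:
  fixes v :: "real^'d \<Rightarrow> real^'j::finite"
  assumes "v \<in> lsq \<Omega>" "AE x in L. v x = w x"
  shows "w \<in> lsq \<Omega>"
proof -
  have "(\<lambda>x. if x \<in> \<Omega> then v x else 0) \<in> borel_measurable lebesgue"
    using assms(1) by (simp add: lsq_def borel_measurable_if)
  moreover have "AE x in lebesgue. (if x \<in> \<Omega> then v x else 0) = (if x \<in> \<Omega> then w x else 0)"
    using assms(2) by (auto simp: AE_restrict_space_iff elim: AE_mp)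
  ultimately have "(\<lambda>x. if x \<in> \<Omega> then w x else 0) \<in> borel_measurable lebesgue"
    by (rule borel_measurable_AE)
  then have w: "w \<in> borel_measurable L" by (simp add: borel_measurable_if)
  have "integrable L (\<lambda>x. (norm (w x))\<^sup>2)"
    using assms w by (subst integrable_cong_AE[where g = "\<lambda>x. (norm (v x))\<^sup>2"]) (auto simp: lsq_def)
  then show ?thesis using w by (simp add: lsq_def)
qed

lemma sobolev_1_cong_AE:
  fixes v :: "real^'d \<Rightarrow> real^'j::finite"
  assumes v: "v \<in> sobolev 1 \<Omega>" and eq: "AE x in L. v x = w x"
  shows "w \<in> sobolev 1 \<Omega>"
proof -
  have w: "w \<in> lsq \<Omega>" using lsq_cong_AE[OF sobolev_1_lsq[OF v] eq] .
  have "weak_partial \<Omega> i w (wpd \<Omega> i v)" for i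
    unfolding weak_partial_def
  proof (intro allI impI)
    fix \<psi> assume \<psi>: "test_function \<Omega> \<psi>"
    have "AE x in L. pd i \<psi> x *\<^sub>R w x = pd i \<psi> x *\<^sub>R v x" using eq by auto
    then have "(LINT x|L. pd i \<psi> x *\<^sub>R w x) = (LINT x|L. pd i \<psi> x *\<^sub>R v x)"
      by (intro integral_cong_AE borel_measurable_integrable integrable_test_function_scaleR(2)[OF \<psi>]
          w sobolev_1_lsq[OF v])
    also have "\<dots> = - (LINT x|L. \<psi> x *\<^sub>R wpd \<Omega> i v x)"
      using weak_partial_wpd[OF v] \<psi> by (simp add: weak_partial_def)
    finally show "(LINT x|L. pd i \<psi> x *\<^sub>R w x) = - (LINT x|L. \<psi> x *\<^sub>R wpd \<Omega> i v x)" .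
  qed
  with w wpd_lsq[OF v] show ?thesis unfolding sobolev_1_iff by (intro conjI allI bexI)
qed

end

section \<open>Solvability of nonlinear Galerkin equations\<close>

lemma fe_fun_Suc: "fe_fun (Suc n) \<beta> U = (\<lambda>x. 1 *\<^sub>R fe_fun n \<beta> U x + U n *\<^sub>R \<beta> n x)"
  by (auto simp: fe_fun_def)

lemma fe_fun_lin: "(\<lambda>x. a *\<^sub>R fe_fun n \<beta> U x + b *\<^sub>R fe_fun n \<beta> V x) = fe_fun n \<beta> (\<lambda>l. a * U l + b * V l)"
  by (simp add: fun_eq_iff fe_fun_def scaleR_sum_right sum.distrib scaleR_add_left)

lemma fe_space_lin:
  assumes "v \<in> fe_space n \<beta>" "w \<in> fe_space n \<beta>"
  shows "(\<lambda>x. a *\<^sub>R v x + b *\<^sub>R w x) \<in> fe_space n \<beta>"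
  using assms by (auto simp: fe_space_def fe_fun_lin)

lemma fe_space_zero: "(\<lambda>_. 0) \<in> fe_space n \<beta>"
  unfolding fe_space_def by (rule range_eqI[of _ _ "\<lambda>_. 0"]) (simp add: fe_fun_def fun_eq_iff)

lemma fe_space_scaleR: "v \<in> fe_space n \<beta> \<Longrightarrow> (\<lambda>x. a *\<^sub>R v x) \<in> fe_space n \<beta>"
  using fe_space_lin[of v n \<beta> v a 0] by simp

lemma fe_space_add: "v \<in> fe_space n \<beta> \<Longrightarrow> w \<in> fe_space n \<beta> \<Longrightarrow> (\<lambda>x. v x + w x) \<in> fe_space n \<beta>"
  using fe_space_lin[of v n \<beta> w 1 1] by simp

lemma fe_space_diff: "v \<in> fe_space n \<beta> \<Longrightarrow> w \<in> fe_space n \<beta> \<Longrightarrow> (\<lambda>x. v x - w x) \<in> fe_space n \<beta>"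
  using fe_space_lin[of v n \<beta> w 1 "-1"] by simp

lemma fe_space_sum: "(\<And>i. i \<in> I \<Longrightarrow> v i \<in> fe_space n \<beta>) \<Longrightarrow> (\<lambda>x. \<Sum>i\<in>I. v i x) \<in> fe_space n \<beta>"
  by (induction I rule: infinite_finite_induct) (auto simp: fe_space_zero intro: fe_space_add)

lemma basis_in_fe_space:
  assumes "l < n" shows "\<beta> l \<in> fe_space n \<beta>"
proof -
  have "\<beta> l x = fe_fun n \<beta> (\<lambda>i. if i = l then 1 else 0) x" for x
    using assms by (simp add: fe_fun_def if_distrib[of "\<lambda>c. c *\<^sub>R _"] cong: if_cong)
  then show ?thesis unfolding fe_space_def by (intro range_eqI) blast
qed

locale finite_element_space = bounded_open_set \<Omega> for \<Omega> :: "(real^'d::finite) set" +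
  fixes Nh :: nat and \<beta> :: "nat \<Rightarrow> real^'d \<Rightarrow> real^'j::finite" and M :: "real^'j^'j"
  assumes independent: "(\<And>x. x \<in> \<Omega> \<Longrightarrow> fe_fun Nh \<beta> U x = 0) \<Longrightarrow> l < Nh \<Longrightarrow> U l = 0"
    and basis_continuous: "l < Nh \<Longrightarrow> continuous_on (closure \<Omega>) (\<beta> l)"
    and basis_sobolev: "l < Nh \<Longrightarrow> \<beta> l \<in> sobolev 1 \<Omega>"
    and M_positive: "\<forall>y. y \<noteq> 0 \<longrightarrow> 0 < (M *v y) \<bullet> y"
begin

abbreviation "Sh \<equiv> fe_space Nh \<beta>"

lemma fe_space_induct:
  assumes "v \<in> Sh" "P (\<lambda>_. 0)" "\<And>l. l < Nh \<Longrightarrow> P (\<beta> l)"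
    "\<And>v w a b. P v \<Longrightarrow> P w \<Longrightarrow> P (\<lambda>x. a *\<^sub>R v x + b *\<^sub>R w x)"
  shows "P v"
proof -
  have "P (fe_fun n \<beta> U)" if "n \<le> Nh" for n U
    using that
  proof (induction n)
    case 0
    have "fe_fun 0 \<beta> U = (\<lambda>_. 0)" by (simp add: fe_fun_def fun_eq_iff)
    then show ?case using assms(2) by simp
  next
    case (Suc n)
    then show ?case unfolding fe_fun_Suc by (intro assms(3,4)) auto
  qed
  then show ?thesis using assms(1) by (auto simp: fe_space_def)
qed

lemma fe_space_continuous: "v \<in> Sh \<Longrightarrow> continuous_on (closure \<Omega>) v"
  by (erule fe_space_induct) (auto intro!: continuous_intros basis_continuous)

lemma fe_space_sobolev:
  assumes "v \<in> Sh" shows "v \<in> sobolev 1 \<Omega>"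
  using assms
proof (rule fe_space_induct)
  show "(\<lambda>_. 0) \<in> sobolev 1 \<Omega>" by (rule Ck_in_sobolev_1[OF Ck_on_const])
  show "\<beta> l \<in> sobolev 1 \<Omega>" if "l < Nh" for l by (rule basis_sobolev[OF that])
qed (rule sobolev_1_lin)

lemma fe_space_lsq: "v \<in> Sh \<Longrightarrow> v \<in> lsq \<Omega>"
  by (rule sobolev_1_lsq[OF fe_space_sobolev])

definition linear_functional :: "((real^'d \<Rightarrow> real^'j) \<Rightarrow> real) \<Rightarrow> bool" where
  "linear_functional F \<longleftrightarrow> (\<forall>v\<in>Sh. \<forall>w\<in>Sh. \<forall>a b. F (\<lambda>x. a *\<^sub>R v x + b *\<^sub>R w x) = a * F v + b * F w)"

lemma linear_functional_expand:
  assumes F: "linear_functional F"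
  shows "F (fe_fun Nh \<beta> U) = (\<Sum>l<Nh. U l * F (\<beta> l))"
proof -
  have "fe_fun n \<beta> U \<in> Sh \<and> F (fe_fun n \<beta> U) = (\<Sum>l<n. U l * F (\<beta> l))" if "n \<le> Nh" for n
    using that
  proof (induction n)
    case 0
    have "F (\<lambda>x. 0 *\<^sub>R (\<lambda>_. 0) x + 0 *\<^sub>R (\<lambda>_. 0) x) = 0 * F (\<lambda>_. 0) + 0 * F (\<lambda>_. 0)"
      using F[unfolded linear_functional_def, rule_format, OF fe_space_zero fe_space_zero] .
    moreover have "fe_fun 0 \<beta> U = (\<lambda>_. 0)" by (simp add: fe_fun_def fun_eq_iff)
    ultimately show ?case by (simp add: fe_space_zero)
  next
    case (Suc n)
    then have IH: "fe_fun n \<beta> U \<in> Sh" "F (fe_fun n \<beta> U) = (\<Sum>l<n. U l * F (\<beta> l))" and \<beta>: "\<beta> n \<in> Sh"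
      using basis_in_fe_space[of n Nh \<beta>] by auto
    then have "F (fe_fun (Suc n) \<beta> U) = 1 * F (fe_fun n \<beta> U) + U n * F (\<beta> n)"
      unfolding fe_fun_Suc using F[unfolded linear_functional_def, rule_format, OF IH(1) \<beta>] by blast
    moreover have "fe_fun (Suc n) \<beta> U \<in> Sh"
      unfolding fe_fun_Suc by (rule fe_space_lin[OF IH(1) \<beta>])
    ultimately show ?case using IH(2) by simp
  qed
  then show ?thesis by simp
qed

lemma linear_functional_add: "linear_functional F \<Longrightarrow> linear_functional G \<Longrightarrow> linear_functional (\<lambda>v. F v + G v)"
  by (simp add: linear_functional_def algebra_simps)

lemma linear_functional_diff: "linear_functional F \<Longrightarrow> linear_functional G \<Longrightarrow> linear_functional (\<lambda>v. F v - G v)"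
  by (simp add: linear_functional_def algebra_simps)

lemma linear_functional_mult: "linear_functional F \<Longrightarrow> linear_functional (\<lambda>v. c * F v)"
  by (simp add: linear_functional_def algebra_simps)

lemma linear_functional_l2: "z \<in> lsq \<Omega> \<Longrightarrow> linear_functional (l2_inner \<Omega> z)"
  by (simp add: linear_functional_def l2_inner_lin_right fe_space_lsq)

lemma linear_functional_l2_left: "z \<in> lsq \<Omega> \<Longrightarrow> linear_functional (\<lambda>v. l2_inner \<Omega> v z)"
  by (simp add: linear_functional_def l2_inner_lin_left fe_space_lsq)

lemma linear_functional_grad: "z \<in> sobolev 1 \<Omega> \<Longrightarrow> linear_functional (grad_inner \<Omega> M z)"
  unfolding linear_functional_def
  by (intro ballI allI grad_inner_lin_right[OF fe_space_sobolev fe_space_sobolev])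

lemma linear_functional_grad_left: "z \<in> sobolev 1 \<Omega> \<Longrightarrow> linear_functional (\<lambda>v. grad_inner \<Omega> M v z)"
  unfolding linear_functional_def
  by (intro ballI allI grad_inner_lin_left[OF fe_space_sobolev fe_space_sobolev])

lemma linear_functional_continuous:
  assumes "linear_functional F"
  shows "continuous_on UNIV (\<lambda>U. F (fe_fun Nh \<beta> U))"
  unfolding linear_functional_expand[OF assms]
  by (intro continuous_intros continuous_on_product_coordinates)

lemma fe_fun_in: "fe_fun Nh \<beta> U \<in> Sh" by (simp add: fe_space_def)

lemma l2_inner_self_nonneg: "0 \<le> l2_inner \<Omega> v v"
  unfolding l2_inner_def by (intro Bochner_Integration.integral_nonneg) simp

lemma l2_definite:
  assumes v: "v \<in> Sh" and zero: "l2_inner \<Omega> v v = 0" and x: "x \<in> \<Omega>"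
  shows "v x = 0"
proof (rule ccontr)
  assume nz: "v x \<noteq> 0"
  have "AE x in L. v x \<bullet> v x = 0"
    using zero integral_nonneg_eq_0_iff_AE[OF integrable_inner_lsq[OF fe_space_lsq[OF v] fe_space_lsq[OF v]]]
    by (simp add: l2_inner_def)
  then have "AE x in lebesgue. x \<notin> {x \<in> \<Omega>. v x \<noteq> 0}" by (simp add: AE_restrict_space_iff)
  moreover have op: "open {x \<in> \<Omega>. v x \<noteq> 0}"
    using continuous_open_preimage[OF continuous_on_subset[OF fe_space_continuous[OF v] closure_subset] open_domain, of "- {0}"]
    by (simp add: vimage_def Int_def conj_commute open_Compl)
  ultimately have "{x \<in> \<Omega>. v x \<noteq> 0} \<in> null_sets lebesgue"
    by (subst (asm) AE_iff_null_sets[symmetric]) auto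
  then show False
    using open_not_negligible[OF op] nz x by (auto simp: negligible_iff_null_sets)
qed

text \<open>Elements of the finite element space are functions on the whole of \<open>\<real>\<^sup>d\<close>, but their values on the domain
determine the coefficients. Without this the projection could not be unique as a function.\<close>

lemma fe_space_eqI:
  assumes "\<And>x. x \<in> \<Omega> \<Longrightarrow> v x = w x" "v \<in> Sh" "w \<in> Sh"
  shows "v = w"
proof -
  obtain U V where UV: "v = fe_fun Nh \<beta> U" "w = fe_fun Nh \<beta> V" using assms by (auto simp: fe_space_def)
  have "fe_fun Nh \<beta> (\<lambda>l. 1 * U l + (-1) * V l) x = 0" if "x \<in> \<Omega>" for x
    using assms(1)[OF that] unfolding UV fe_fun_lin[symmetric] by simp
  then have "1 * U l + (-1) * V l = 0" if "l < Nh" for l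
    using independent[of "\<lambda>l. 1 * U l + (-1) * V l" l] that by blast
  then show ?thesis by (auto simp: UV fe_fun_def)
qed

text \<open>The quadratic form of the Gram matrix is continuous and positive on the compact set of coefficient
vectors of maximum norm one, hence bounded below there by some \<open>m > 0\<close>; the rest is homogeneity.\<close>

lemma gram_lower_bound:
  obtains m where "0 < m" "\<And>U R i. 0 < R \<Longrightarrow> (\<And>l. \<bar>U l\<bar> \<le> R) \<Longrightarrow> i < Nh \<Longrightarrow> \<bar>U i\<bar> = R \<Longrightarrow>
    m * R\<^sup>2 \<le> l2_inner \<Omega> (fe_fun Nh \<beta> U) (fe_fun Nh \<beta> U)"
proof -
  define q where "q U = l2_inner \<Omega> (fe_fun Nh \<beta> U) (fe_fun Nh \<beta> U)" for U
  have q: "q U = (\<Sum>l<Nh. U l * l2_inner \<Omega> (fe_fun Nh \<beta> U) (\<beta> l))" for U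
    unfolding q_def by (rule linear_functional_expand[OF linear_functional_l2[OF fe_space_lsq[OF fe_fun_in]]])
  have "continuous_on UNIV (\<lambda>U. \<Sum>l<Nh. U l * l2_inner \<Omega> (fe_fun Nh \<beta> U) (\<beta> l))"
    by (intro continuous_on_sum continuous_on_mult continuous_on_product_coordinates
        linear_functional_continuous linear_functional_l2_left fe_space_lsq basis_in_fe_space) simp
  then have contq: "continuous_on UNIV q" by (simp add: q[symmetric])
  have "\<exists>m>0. \<forall>V. (\<forall>l. \<bar>V l\<bar> \<le> 1) \<and> \<bar>V i\<bar> = 1 \<longrightarrow> m \<le> q V" if i: "i < Nh" for i
  proof -
    let ?K = "{V. \<forall>l. \<bar>V l\<bar> \<le> 1} \<inter> {V. \<bar>V i\<bar> = 1} :: (nat \<Rightarrow> real) set"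
    have K: "compact ?K"
      by (intro compact_Int_closed compact_sequence_cube closed_Collect_eq continuous_intros continuous_on_product_coordinates)
    have "(\<lambda>_. 1) \<in> ?K" by simp
    then have "?K \<noteq> {}" by (rule ex_in_conv[THEN iffD1, OF exI])
    from continuous_attains_inf[OF K this continuous_on_subset[OF contq subset_UNIV]]
    obtain V where V: "V \<in> ?K" "\<And>W. W \<in> ?K \<Longrightarrow> q V \<le> q W" by blast
    have "q V \<noteq> 0"
    proof
      assume "q V = 0"
      then have "V i = 0" using l2_definite[OF fe_fun_in] independent[of V i] i by (simp add: q_def)
      then show False using V(1) by simp
    qed
    then have "0 < q V" using l2_inner_self_nonneg by (simp add: q_def order_less_le)
    then show ?thesis using V(2) by auto
  qed
  then obtain m where m: "\<And>i. i < Nh \<Longrightarrow> 0 < m i" "\<And>i V. i < Nh \<Longrightarrow> (\<forall>l. \<bar>V l\<bar> \<le> 1) \<Longrightarrow> \<bar>V i\<bar> = 1 \<Longrightarrow> m i \<le> q V"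
    by metis
  let ?m = "Min (insert 1 (m ` {..<Nh}))"
  show ?thesis
  proof
    show "0 < ?m" using m(1) by auto
    fix U :: "nat \<Rightarrow> real" and R i assume R: "0 < R" and U: "\<And>l. \<bar>U l\<bar> \<le> R" and i: "i < Nh" "\<bar>U i\<bar> = R"
    define V where "V = (\<lambda>l. U l / R)"
    have V: "U = (\<lambda>l. R * V l + 0 * V l)" using R by (simp add: V_def)
    have "?m \<le> m i" using i by (intro Min_le) auto
    also have "m i \<le> q V" using m(2)[OF i(1), of V] U i(2) R by (simp add: V_def)
    finally have "?m * R\<^sup>2 \<le> q V * R\<^sup>2" by (intro mult_right_mono) auto
    also have "q V * R\<^sup>2 = q U"
    proof -
      have "fe_fun Nh \<beta> U = (\<lambda>x. R *\<^sub>R fe_fun Nh \<beta> V x + 0 *\<^sub>R fe_fun Nh \<beta> V x)"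
        unfolding fe_fun_lin by (subst V) simp
      then show ?thesis
        unfolding q_def by (simp add: l2_inner_def power2_eq_square mult_ac)
    qed
    finally show "?m * R\<^sup>2 \<le> l2_inner \<Omega> (fe_fun Nh \<beta> U) (fe_fun Nh \<beta> U)" by (simp add: q_def)
  qed
qed

text \<open>The equation says that the residual, a linear functional on the space, is zero, and it suffices that
its coordinates in the basis vanish. They depend continuously on the coefficients \<open>U\<close> of \<open>Y\<close>, by
dominated convergence in the nonlinear term. Testing with \<open>Y\<close> itself gives at least
\<open>(c - \<Lambda>) \<parallel>Y\<parallel>\<^sup>2 - K \<parallel>Y\<parallel>\<^sub>1 - F(Y)\<close>, since the gradient form is nonnegative; on the boundary of the cube of
half width \<open>R\<close> the first term is of order \<open>R\<^sup>2\<close> and the others are of order \<open>R\<close>. So the vector of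
coordinates points outwards there for large \<open>R\<close>.\<close>

lemma nonlinear_galerkin_solvable:
  fixes g :: "real^'d \<Rightarrow> real^'j \<Rightarrow> real^'j"
  assumes g: "continuous_on (closure \<Omega> \<times> UNIV) (\<lambda>(x, y). g x y)"
    and lower: "\<And>x y. x \<in> \<Omega> \<Longrightarrow> - \<Lambda> * (norm y)\<^sup>2 - K * norm y \<le> g x y \<bullet> y"
    and c: "\<Lambda> < c" and K: "0 \<le> K" and F: "linear_functional F"
  obtains Y where "Y \<in> Sh" "\<And>\<psi>. \<psi> \<in> Sh \<Longrightarrow>
    c * l2_inner \<Omega> Y \<psi> + grad_inner \<Omega> M Y \<psi> + l2_inner \<Omega> (\<lambda>x. g x (Y x)) \<psi> = F \<psi>"
proof -
  have cont_comp: "continuous_on (closure \<Omega>) (\<lambda>x. g x (Y x))" if "Y \<in> Sh" for Y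
  proof -
    have "continuous_on (closure \<Omega>) (\<lambda>x. (\<lambda>(x, y). g x y) (x, Y x))"
      by (rule continuous_on_compose2[OF g]) (auto intro!: continuous_intros fe_space_continuous that)
    then show ?thesis by simp
  qed
  define residual where "residual U \<psi> = c * l2_inner \<Omega> (fe_fun Nh \<beta> U) \<psi> + grad_inner \<Omega> M (fe_fun Nh \<beta> U) \<psi>
      + l2_inner \<Omega> (\<lambda>x. g x (fe_fun Nh \<beta> U x)) \<psi> - F \<psi>" for U \<psi>
  have residual_linear: "linear_functional (residual U)" for U
    unfolding residual_def
    by (intro linear_functional_add linear_functional_diff linear_functional_mult linear_functional_l2 linear_functional_grad F
        fe_space_lsq fe_space_sobolev fe_fun_in continuous_in_lsq cont_comp)
  have residual_continuous: "continuous_on UNIV (\<lambda>U. residual U (\<beta> m))" if m: "m < Nh" for m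
  proof -
    note \<beta>m = basis_in_fe_space[OF m, of \<beta>]
    have "continuous_on UNIV (\<lambda>U. l2_inner \<Omega> (\<lambda>x. g x (fe_fun Nh \<beta> U x)) (\<beta> m))"
      unfolding continuous_on_sequentially
    proof (intro ballI allI impI, elim conjE)
      fix U :: "nat \<Rightarrow> real" and Us assume lim: "Us \<longlonglongrightarrow> U"
      have coord: "(\<lambda>n. Us n l) \<longlonglongrightarrow> U l" for l using lim by (simp add: tendsto_fun_iff)
      have "\<exists>C. \<forall>n. \<bar>Us n l\<bar> \<le> C" for l
        using convergent_imp_Bseq[OF convergentI[OF coord[of l]]] unfolding Bseq_def by auto
      then obtain C where C: "\<And>n l. \<bar>Us n l\<bar> \<le> C l" by metis
      have "\<exists>B. \<forall>x\<in>closure \<Omega>. norm (\<beta> l x) \<le> B" if "l < Nh" for l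
        using compact_imp_bounded[OF compact_continuous_image[OF basis_continuous[OF that]]] bounded_domain
        by (auto simp: bounded_iff)
      then obtain B where B: "\<And>l x. l < Nh \<Longrightarrow> x \<in> closure \<Omega> \<Longrightarrow> norm (\<beta> l x) \<le> B l" by metis
      define r where "r = (\<Sum>l<Nh. C l * B l)"
      have bound: "norm (fe_fun Nh \<beta> (Us n) x) \<le> r" if x: "x \<in> closure \<Omega>" for n x
        unfolding fe_fun_def r_def
      proof (rule sum_norm_le)
        fix l assume "l \<in> {..<Nh}"
        then show "norm (Us n l *\<^sub>R \<beta> l x) \<le> C l * B l"
          using B[of l x] C[of n l] x by (auto intro!: mult_mono intro: order_trans[OF abs_ge_zero])
      qed
      have "compact (closure \<Omega> \<times> cball (0 :: real^'j) r)"
        using bounded_domain by (intro compact_Times) auto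
      then have "bounded ((\<lambda>(x, y). g x y) ` (closure \<Omega> \<times> cball 0 r))"
        by (intro compact_imp_bounded compact_continuous_image continuous_on_subset[OF g]) auto
      then obtain G where "\<forall>p\<in>closure \<Omega> \<times> cball 0 r. norm ((\<lambda>(x, y). g x y) p) \<le> G"
        by (auto simp: bounded_iff)
      then have G: "norm (g x y) \<le> G" if "x \<in> closure \<Omega>" "norm y \<le> r" for x y
        using that by force
      have lsq: "(\<lambda>x. g x (fe_fun Nh \<beta> V x)) \<in> lsq \<Omega>" for V by (intro continuous_in_lsq cont_comp fe_fun_in)
      have "(\<lambda>n. l2_inner \<Omega> (\<lambda>x. g x (fe_fun Nh \<beta> (Us n) x)) (\<beta> m)) \<longlonglongrightarrow>
          l2_inner \<Omega> (\<lambda>x. g x (fe_fun Nh \<beta> U x)) (\<beta> m)"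
        unfolding l2_inner_def
      proof (rule integral_dominated_convergence[where w = "\<lambda>x. G * B m"])
        show "(\<lambda>x. g x (fe_fun Nh \<beta> U x) \<bullet> \<beta> m x) \<in> borel_measurable L"
          by (intro borel_measurable_integrable integrable_inner_lsq lsq fe_space_lsq \<beta>m)
        show "(\<lambda>x. g x (fe_fun Nh \<beta> (Us n) x) \<bullet> \<beta> m x) \<in> borel_measurable L" for n
          by (intro borel_measurable_integrable integrable_inner_lsq lsq fe_space_lsq \<beta>m)
        show "AE x in L. (\<lambda>n. g x (fe_fun Nh \<beta> (Us n) x) \<bullet> \<beta> m x) \<longlonglongrightarrow> g x (fe_fun Nh \<beta> U x) \<bullet> \<beta> m x"
        proof (intro AE_I2 tendsto_inner tendsto_const)
          fix x assume "x \<in> space L"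
          then have x: "x \<in> closure \<Omega>" using closure_subset by auto
          have fe: "(\<lambda>n. fe_fun Nh \<beta> (Us n) x) \<longlonglongrightarrow> fe_fun Nh \<beta> U x"
            unfolding fe_fun_def by (intro tendsto_intros coord)
          have "continuous_on UNIV (\<lambda>y. (\<lambda>(x, y). g x y) (x, y))"
            by (rule continuous_on_compose2[OF g]) (use x in \<open>auto intro!: continuous_intros\<close>)
          then have "isCont (g x) (fe_fun Nh \<beta> U x)" by (simp add: continuous_on_eq_continuous_at)
          then show "(\<lambda>n. g x (fe_fun Nh \<beta> (Us n) x)) \<longlonglongrightarrow> g x (fe_fun Nh \<beta> U x)"
            using fe by (rule isCont_tendsto_compose)
        qed
        show "AE x in L. norm (g x (fe_fun Nh \<beta> (Us n) x) \<bullet> \<beta> m x) \<le> G * B m" for n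
        proof (intro AE_I2)
          fix x assume "x \<in> space L"
          then have x: "x \<in> closure \<Omega>" using closure_subset by auto
          have "norm (g x (fe_fun Nh \<beta> (Us n) x) \<bullet> \<beta> m x) \<le> norm (g x (fe_fun Nh \<beta> (Us n) x)) * norm (\<beta> m x)"
            by (simp add: Cauchy_Schwarz_ineq2)
          also have "\<dots> \<le> G * B m" using G[OF x bound[OF x]] B[OF m x]
            by (intro mult_mono) (auto intro: order_trans[OF norm_ge_zero])
          finally show "norm (g x (fe_fun Nh \<beta> (Us n) x) \<bullet> \<beta> m x) \<le> G * B m" .
        qed
      qed simp
      then show "((\<lambda>U. l2_inner \<Omega> (\<lambda>x. g x (fe_fun Nh \<beta> U x)) (\<beta> m)) \<circ> Us) \<longlonglongrightarrow>
          l2_inner \<Omega> (\<lambda>x. g x (fe_fun Nh \<beta> U x)) (\<beta> m)" by (simp add: o_def)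
    qed
    then show ?thesis
      unfolding residual_def
      by (intro continuous_intros linear_functional_continuous[of "\<lambda>v. l2_inner \<Omega> v (\<beta> m)"]
         linear_functional_continuous[of "\<lambda>v. grad_inner \<Omega> M v (\<beta> m)"] linear_functional_l2_left
         linear_functional_grad_left fe_space_lsq fe_space_sobolev \<beta>m)
  qed
  obtain m where m: "0 < m" and gram: "\<And>U R i. 0 < R \<Longrightarrow> (\<And>l. \<bar>U l\<bar> \<le> R) \<Longrightarrow> i < Nh \<Longrightarrow> \<bar>U i\<bar> = R \<Longrightarrow>
    m * R\<^sup>2 \<le> l2_inner \<Omega> (fe_fun Nh \<beta> U) (fe_fun Nh \<beta> U)" using gram_lower_bound by blast
  define A where "A = (\<Sum>l<Nh. K * (LINT x|L. norm (\<beta> l x)) + \<bar>F (\<beta> l)\<bar>)"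
  have "0 \<le> A" unfolding A_def by (intro sum_nonneg) (simp add: K)
  \<comment> \<open>\<open>R A\<close> bounds the lower order terms on the cube of half width \<open>R\<close>, and \<open>(c - \<Lambda>) m R\<^sup>2\<close> bounds the
      quadratic term from below on its boundary.\<close>
  define R where "R = (A + 1) / ((c - \<Lambda>) * m)"
  have cm: "0 < (c - \<Lambda>) * m" using c m by simp
  then have R: "0 < R" "A < (c - \<Lambda>) * m * R" using \<open>0 \<le> A\<close> by (auto simp: R_def)
  have coercive: "0 < (\<Sum>l<Nh. residual U (\<beta> l) * U l)" if U: "\<forall>l. \<bar>U l\<bar> \<le> R" "i < Nh" "\<bar>U i\<bar> = R" for U i
  proof -
    let ?Y = "fe_fun Nh \<beta> U"
    have Y: "?Y \<in> lsq \<Omega>" "(\<lambda>x. g x (?Y x)) \<in> lsq \<Omega>"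
      by (intro fe_space_lsq fe_fun_in continuous_in_lsq cont_comp)+
    have int_norm: "integrable L (\<lambda>x. norm (v x))" if "v \<in> Sh" for v
      using lsq_imp_integrable[OF fe_space_lsq[OF that]] by simp
    have "K * (LINT x|L. norm (?Y x)) + F ?Y \<le> R * A"
    proof -
      have "(LINT x|L. norm (?Y x)) \<le> (LINT x|L. (\<Sum>l<Nh. \<bar>U l\<bar> * norm (\<beta> l x)))"
        by (intro integral_mono int_norm fe_fun_in Bochner_Integration.integrable_sum integrable_mult_right basis_in_fe_space)
          (auto simp: fe_fun_def intro!: order_trans[OF norm_sum])
      also have "\<dots> = (\<Sum>l<Nh. \<bar>U l\<bar> * (LINT x|L. norm (\<beta> l x)))"
        by (subst Bochner_Integration.integral_sum) (auto intro!: int_norm basis_in_fe_space)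
      finally have "K * (LINT x|L. norm (?Y x)) \<le> K * (\<Sum>l<Nh. \<bar>U l\<bar> * (LINT x|L. norm (\<beta> l x)))"
        using K by (rule mult_left_mono)
      moreover have "F ?Y \<le> (\<Sum>l<Nh. \<bar>U l\<bar> * \<bar>F (\<beta> l)\<bar>)"
        unfolding linear_functional_expand[OF F] by (intro sum_mono) (simp add: abs_mult[symmetric])
      ultimately have "K * (LINT x|L. norm (?Y x)) + F ?Y \<le>
          (\<Sum>l<Nh. \<bar>U l\<bar> * (K * (LINT x|L. norm (\<beta> l x)) + \<bar>F (\<beta> l)\<bar>))"
        by (simp add: sum_distrib_left sum.distrib algebra_simps)
      also have "\<dots> \<le> (\<Sum>l<Nh. R * (K * (LINT x|L. norm (\<beta> l x)) + \<bar>F (\<beta> l)\<bar>))"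
        using U(1) K by (intro sum_mono mult_right_mono) auto
      finally show ?thesis by (simp add: A_def sum_distrib_left)
    qed
    moreover have "- \<Lambda> * l2_inner \<Omega> ?Y ?Y - K * (LINT x|L. norm (?Y x)) \<le> l2_inner \<Omega> (\<lambda>x. g x (?Y x)) ?Y"
    proof -
      have "(LINT x|L. - \<Lambda> * (?Y x \<bullet> ?Y x) - K * norm (?Y x)) \<le> (LINT x|L. g x (?Y x) \<bullet> ?Y x)"
        using lower by (intro integral_mono integrable_inner_lsq Y Bochner_Integration.integrable_diff integrable_mult_right
            int_norm fe_fun_in) (auto simp: power2_norm_eq_inner)
      also have "(LINT x|L. - \<Lambda> * (?Y x \<bullet> ?Y x) - K * norm (?Y x)) = - \<Lambda> * (LINT x|L. ?Y x \<bullet> ?Y x) - K * (LINT x|L. norm (?Y x))"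
        by (subst Bochner_Integration.integral_diff)
          (auto intro!: integrable_inner_lsq Y int_norm fe_fun_in)
      finally show ?thesis by (simp add: l2_inner_def)
    qed
    moreover have "R * A < (c - \<Lambda>) * l2_inner \<Omega> ?Y ?Y"
    proof -
      have "R * A < R * ((c - \<Lambda>) * m * R)" using R by (intro mult_strict_left_mono)
      also have "\<dots> = (c - \<Lambda>) * (m * R\<^sup>2)" by (simp add: power2_eq_square)
      also have "\<dots> \<le> (c - \<Lambda>) * l2_inner \<Omega> ?Y ?Y"
        using gram[of R U i] R(1) U c by (intro mult_left_mono) auto
      finally show ?thesis .
    qed
    moreover have "0 \<le> grad_inner \<Omega> M ?Y ?Y" by (rule grad_inner_nonneg[OF M_positive])
    ultimately have "0 < residual U ?Y" by (simp add: residual_def algebra_simps)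
    then show ?thesis by (simp add: linear_functional_expand[OF residual_linear] mult.commute)
  qed
  obtain U where U: "\<And>l. l < Nh \<Longrightarrow> residual U (\<beta> l) = 0"
    using zero_of_coercive_map[where P = "\<lambda>U l. residual U (\<beta> l)" and n = Nh and R = R] residual_continuous R(1) coercive by blast
  show ?thesis
  proof
    show "fe_fun Nh \<beta> U \<in> Sh" by (rule fe_fun_in)
    fix \<psi> assume "\<psi> \<in> Sh"
    then obtain W where "\<psi> = fe_fun Nh \<beta> W" by (auto simp: fe_space_def)
    then have "residual U \<psi> = 0" using U by (simp add: linear_functional_expand[OF residual_linear])
    then show "c * l2_inner \<Omega> (fe_fun Nh \<beta> U) \<psi> + grad_inner \<Omega> M (fe_fun Nh \<beta> U) \<psi>
      + l2_inner \<Omega> (\<lambda>x. g x (fe_fun Nh \<beta> U x)) \<psi> = F \<psi>" by (simp add: residual_def)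
  qed
qed

text \<open>The projection is a definite description, so it is in the space only if the defining equations
have exactly one solution. Existence is the Galerkin lemma without a nonlinear term; uniqueness is
positivity of the inner product. Both need bilinearity of the gradient form on \<open>v - w\<close>, hence
that \<open>v\<close> has weak derivatives.\<close>

lemma R_h_in_fe_space:
  assumes v: "v \<in> sobolev 1 \<Omega>"
  shows "R_h \<Omega> M Sh v \<in> Sh"
proof -
  let ?orth = "\<lambda>w. \<forall>\<psi>\<in>Sh. l2_inner \<Omega> (\<lambda>x. v x - w x) \<psi> + grad_inner \<Omega> M (\<lambda>x. v x - w x) \<psi> = 0"
  have split: "l2_inner \<Omega> (\<lambda>x. z x - w x) \<psi> + grad_inner \<Omega> M (\<lambda>x. z x - w x) \<psi>
      = (l2_inner \<Omega> z \<psi> + grad_inner \<Omega> M z \<psi>) - (l2_inner \<Omega> w \<psi> + grad_inner \<Omega> M w \<psi>)"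
    if "z \<in> sobolev 1 \<Omega>" "w \<in> Sh" "\<psi> \<in> Sh" for z w \<psi>
    using l2_inner_lin_left[of z w \<psi> 1 "-1"] grad_inner_lin_left[of z w \<psi> M 1 "-1"] that fe_space_sobolev
      fe_space_lsq sobolev_1_lsq by auto
  have "linear_functional (\<lambda>\<psi>. l2_inner \<Omega> v \<psi> + grad_inner \<Omega> M v \<psi>)"
    by (intro linear_functional_add linear_functional_l2 linear_functional_grad v sobolev_1_lsq)
  then obtain w where w: "w \<in> Sh" "\<And>\<psi>. \<psi> \<in> Sh \<Longrightarrow> 1 * l2_inner \<Omega> w \<psi> + grad_inner \<Omega> M w \<psi>
      + l2_inner \<Omega> (\<lambda>x. 0) \<psi> = l2_inner \<Omega> v \<psi> + grad_inner \<Omega> M v \<psi>"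
    using nonlinear_galerkin_solvable[of "\<lambda>_ _. 0" 0 0 1] by auto
  have orth: "?orth w" using w split[OF v w(1)] by (auto simp: l2_inner_def)
  moreover have "w' = w" if w': "w' \<in> Sh" "?orth w'" for w'
  proof -
    let ?d = "\<lambda>x. w' x - w x"
    have d: "?d \<in> Sh" by (rule fe_space_diff[OF w'(1) w(1)])
    have "l2_inner \<Omega> ?d ?d + grad_inner \<Omega> M ?d ?d = 0"
      using split[OF fe_space_sobolev[OF w'(1)] w(1) d] split[OF v w(1) d] split[OF v w'(1) d] orth w'(2) d by auto
    then have "l2_inner \<Omega> ?d ?d = 0"
      using l2_inner_self_nonneg[of ?d] grad_inner_nonneg[OF M_positive, of ?d] by linarith
    then have "w' x = w x" if "x \<in> \<Omega>" for x using l2_definite[OF d _ that] by simp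
    then show ?thesis by (rule fe_space_eqI[OF _ w'(1) w(1)])
  qed
  ultimately have "\<exists>!w. w \<in> Sh \<and> ?orth w" using w(1) by blast
  from theI'[OF this] show ?thesis unfolding R_h_def by blast
qed

text \<open>One time step from \<open>w\<close> to \<open>X\<close>, where \<open>dc\<close> and \<open>ec\<close> stand for the correction terms computed from the
previous stage. In terms of \<open>Y = (X + w)/2 - ec\<close> the step is a Galerkin equation with zero order
coefficient \<open>2/k\<close>, and \<open>k \<Lambda> < 2\<close> is exactly the condition that this coefficient dominates the lower
bound \<open>-\<Lambda>\<close> of the nonlinearity.\<close>

lemma crank_nicolson_step_solvable:
  fixes f :: "real^'j \<Rightarrow> real^'j" and \<phi>t Ft :: "real^'d \<Rightarrow> real^'j"
  assumes f: "continuous_on UNIV f" and \<phi>t: "continuous_on (closure \<Omega>) \<phi>t" and Ft: "Ft \<in> lsq \<Omega>"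
    and monotone: "\<And>x y. x \<in> \<Omega> \<Longrightarrow> - \<Lambda> * (norm y)\<^sup>2 \<le> (f (y + \<phi>t x) - f (\<phi>t x)) \<bullet> y"
    and k: "0 < k" "k * \<Lambda> < 2" and Sh: "w \<in> Sh" "dc \<in> Sh" "ec \<in> Sh"
  obtains X where "X \<in> Sh" "\<And>\<psi>. \<psi> \<in> Sh \<Longrightarrow>
    l2_inner \<Omega> (\<lambda>x. (1 / k) *\<^sub>R (X x - w x) - dc x) \<psi>
      + grad_inner \<Omega> M (\<lambda>x. (1 / 2) *\<^sub>R (X x + w x) - ec x) \<psi>
      + l2_inner \<Omega> (\<lambda>x. f ((1 / 2) *\<^sub>R (X x + w x) - ec x + \<phi>t x)) \<psi> = l2_inner \<Omega> Ft \<psi>"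
proof -
  let ?g = "\<lambda>x y. f (y + \<phi>t x)"
  have contg: "continuous_on (closure \<Omega> \<times> UNIV) (\<lambda>(x, y). ?g x y)"
    unfolding case_prod_beta
    by (intro continuous_on_compose2[OF f] continuous_intros continuous_on_compose2[OF \<phi>t]) auto
  have "compact ((\<lambda>x. f (\<phi>t x)) ` closure \<Omega>)"
    using bounded_domain by (intro compact_continuous_image continuous_on_compose2[OF f \<phi>t]) auto
  then obtain K where "\<forall>x\<in>closure \<Omega>. norm (f (\<phi>t x)) \<le> K"
    using compact_imp_bounded by (force simp: bounded_iff)
  then have K: "norm (f (\<phi>t x)) \<le> max K 0" if "x \<in> \<Omega>" for x
    using that closure_subset by (meson le_max_iff_disj subsetD)
  have lower: "- \<Lambda> * (norm y)\<^sup>2 - max K 0 * norm y \<le> ?g x y \<bullet> y" if x: "x \<in> \<Omega>" for x y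
  proof -
    have "\<bar>f (\<phi>t x) \<bullet> y\<bar> \<le> norm (f (\<phi>t x)) * norm y" by (rule Cauchy_Schwarz_ineq2)
    also have "\<dots> \<le> max K 0 * norm y" by (intro mult_right_mono K x norm_ge_zero)
    finally show ?thesis using monotone[OF x, of y] by (simp add: inner_diff_left abs_le_iff)
  qed
  \<comment> \<open>The part of the discrete time derivative that does not depend on \<open>Y\<close>.\<close>
  let ?h = "\<lambda>x. (2 / k) *\<^sub>R (ec x - w x) + (-1) *\<^sub>R dc x"
  have h: "?h \<in> Sh" by (intro fe_space_lin fe_space_diff Sh fe_space_add fe_space_scaleR)
  have lin: "linear_functional (\<lambda>\<psi>. l2_inner \<Omega> Ft \<psi> - l2_inner \<Omega> ?h \<psi>)"
    by (intro linear_functional_diff linear_functional_l2 Ft fe_space_lsq h)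
  have less: "\<Lambda> < 2 / k" using k by (simp add: field_simps)
  obtain Y where Y: "Y \<in> Sh" and eq: "\<And>\<psi>. \<psi> \<in> Sh \<Longrightarrow>
    (2 / k) * l2_inner \<Omega> Y \<psi> + grad_inner \<Omega> M Y \<psi> + l2_inner \<Omega> (\<lambda>x. ?g x (Y x)) \<psi>
      = l2_inner \<Omega> Ft \<psi> - l2_inner \<Omega> ?h \<psi>"
    by (rule nonlinear_galerkin_solvable[OF contg lower less max.cobounded2 lin]) (assumption, rule that)
  let ?X = "\<lambda>x. 2 *\<^sub>R (Y x + ec x) - w x"
  show ?thesis
  proof
    show "?X \<in> Sh" by (intro fe_space_diff fe_space_scaleR fe_space_add Y Sh)
    fix \<psi> assume \<psi>: "\<psi> \<in> Sh"
    have ev: "(1 / 2) *\<^sub>R (?X x + w x) - ec x = Y x" for x by simp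
    have dv: "(1 / k) *\<^sub>R (?X x - w x) - dc x = (2 / k) *\<^sub>R Y x + 1 *\<^sub>R ?h x" for x
    proof -
      have "?X x - w x = 2 *\<^sub>R (Y x + (ec x - w x))" by (simp add: scaleR_2)
      then show ?thesis by (simp only: scaleR_add_right scaleR_scaleR) simp
    qed
    have "l2_inner \<Omega> (\<lambda>x. (2 / k) *\<^sub>R Y x + 1 *\<^sub>R ?h x) \<psi> = (2 / k) * l2_inner \<Omega> Y \<psi> + 1 * l2_inner \<Omega> ?h \<psi>"
      by (rule l2_inner_lin_left) (intro fe_space_lsq Y h \<psi>)+
    then show "l2_inner \<Omega> (\<lambda>x. (1 / k) *\<^sub>R (?X x - w x) - dc x) \<psi>
      + grad_inner \<Omega> M (\<lambda>x. (1 / 2) *\<^sub>R (?X x + w x) - ec x) \<psi>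
      + l2_inner \<Omega> (\<lambda>x. f ((1 / 2) *\<^sub>R (?X x + w x) - ec x + \<phi>t x)) \<psi> = l2_inner \<Omega> Ft \<psi>"
      using eq[OF \<psi>] unfolding ev dv by simp
  qed
qed

end

section \<open>Regularity of the data\<close>

lemma Ck_on_slice:
  "Ck_on m UNIV H \<Longrightarrow> Ck_on m UNIV (\<lambda>x. H (t, x))"
  for H :: "'a::real_normed_vector \<times> 'b::real_normed_vector \<Rightarrow> 'c::real_normed_vector"
proof (induction m arbitrary: H)
  case 0
  then have "continuous_on UNIV H" by simp
  then have "continuous_on UNIV (\<lambda>x. H (t, x))"
    by (rule continuous_on_compose2) (auto intro!: continuous_intros)
  then show ?case by simp
next
  case (Suc m)
  from Suc.prems obtain G where G: "\<And>p. (H has_derivative G p) (at p)" "\<And>v. Ck_on m UNIV (\<lambda>p. G p v)"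
    by (rule Ck_on_SucE) (rule that)
  show ?case
  proof (rule Ck_on_SucI)
    show "((\<lambda>x. H (t, x)) has_derivative (\<lambda>v. G (t, x) (0, v))) (at x)" for x
      by (rule has_derivative_compose[OF _ G(1)]) (auto intro!: derivative_eq_intros)
    show "Ck_on m UNIV (\<lambda>x. G (t, x) (0, v))" for v by (rule Suc.IH[OF G(2)])
  qed
qed

text \<open>The function \<open>\<phi>\<close> agrees with its smooth extension only on the closure of the domain;
derivatives at points of the open domain do not see the difference.\<close>

lemma pd_cong_open:
  assumes "open \<Omega>" "x \<in> \<Omega>" "\<And>y. y \<in> \<Omega> \<Longrightarrow> g y = h y" "h differentiable at x"
  shows "pd i g x = pd i h x"
proof -
  have "(h has_derivative frechet_derivative h (at x)) (at x)"
    using assms(4) by (simp add: frechet_derivative_works)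
  then have "(g has_derivative frechet_derivative h (at x)) (at x)"
    by (rule has_derivative_transform_within_open[OF _ assms(1,2)]) (simp add: assms(3))
  then show ?thesis by (simp add: pd_def frechet_derivative_at[symmetric])
qed

lemma smooth_uptoE:
  assumes "smooth_upto ({0..T} \<times> K) (\<lambda>(t, x). g t x)"
  obtains H where "\<And>m. Ck_on m UNIV H" "\<And>t x. t \<in> {0..T} \<Longrightarrow> x \<in> K \<Longrightarrow> H (t, x) = g t x"
proof -
  obtain H where "smooth_on UNIV H" and H: "\<forall>p\<in>{0..T} \<times> K. H p = (\<lambda>(t, x). g t x) p"
    using assms by (auto simp: smooth_upto_def)
  then have "Ck_on m UNIV H" for m by (simp add: smooth_on_def)
  moreover have "H (t, x) = g t x" if "t \<in> {0..T}" "x \<in> K" for t x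
    using H[rule_format, of "(t, x)"] that by simp
  ultimately show ?thesis by (rule that)
qed

context bounded_open_set begin

text \<open>On the domain, the shifted source is given by derivatives of smooth extensions of \<open>S\<close> and \<open>\<phi>\<close> and so has
a continuous extension to the closure. Its square integrability makes the right hand side of the
scheme linear in the test function.\<close>

lemma shifted_source_lsq:
  fixes S \<phi> :: "real \<Rightarrow> real^'d \<Rightarrow> real^'j::finite"
  assumes S: "smooth_upto ({0..T} \<times> closure \<Omega>) (\<lambda>(t, x). S t x)"
    and \<phi>: "smooth_upto ({0..T} \<times> closure \<Omega>) (\<lambda>(t, x). \<phi> t x)" and t: "0 < t" "t < T"
  shows "shifted_source M S \<phi> t \<in> lsq \<Omega>"
proof -
  obtain H where H: "\<And>m. Ck_on m UNIV H" "\<And>s x. s \<in> {0..T} \<Longrightarrow> x \<in> closure \<Omega> \<Longrightarrow> H (s, x) = S s x"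
    by (rule smooth_uptoE[OF S]) (rule that)
  obtain P where P: "\<And>m. Ck_on m UNIV P" "\<And>s x. s \<in> {0..T} \<Longrightarrow> x \<in> closure \<Omega> \<Longrightarrow> P (s, x) = \<phi> s x"
    by (rule smooth_uptoE[OF \<phi>]) (rule that)
  obtain G where G: "\<And>p. (P has_derivative G p) (at p)" "\<And>v. Ck_on 0 UNIV (\<lambda>p. G p v)"
    using Ck_on_SucE[OF P(1)] by blast
  let ?p = "\<lambda>x. P (t, x)"
  have p: "Ck_on m UNIV ?p" for m by (rule Ck_on_slice[OF P(1)])
  have diff: "h differentiable at x" if "\<And>m. Ck_on m UNIV h" for h :: "real^'d \<Rightarrow> real^'j" and x
    using that[of 1] by simp
  have time: "vector_derivative (\<lambda>s. \<phi> s x) (at t) = G (t, x) (1, 0)" if x: "x \<in> \<Omega>" for x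
  proof -
    have "((\<lambda>s. P (s, x)) has_derivative (\<lambda>h. G (t, x) (h, 0))) (at t)"
      by (rule has_derivative_compose[OF _ G(1)]) (auto intro!: derivative_eq_intros)
    moreover have "(\<lambda>h. G (t, x) (h, 0)) = (\<lambda>h. h *\<^sub>R G (t, x) (1, 0))"
    proof
      show "G (t, x) (h, 0) = h *\<^sub>R G (t, x) (1, 0)" for h
        using linear_cmul[OF has_derivative_linear[OF G(1)], of "(t, x)" h "(1, 0)"] by simp
    qed
    ultimately have "((\<lambda>s. P (s, x)) has_vector_derivative G (t, x) (1, 0)) (at t)"
      unfolding has_vector_derivative_def by metis
    then have "((\<lambda>s. \<phi> s x) has_vector_derivative G (t, x) (1, 0)) (at t)"
      by (rule has_vector_derivative_transform_within_open[of _ _ _ "{0<..<T}"])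
        (use t P(2) subsetD[OF closure_subset x] in auto)
    then show ?thesis by (rule vector_derivative_at)
  qed
  have "shifted_source M S \<phi> t x = H (t, x) - G (t, x) (1, 0) + M *v (\<Sum>i\<in>UNIV. pd i (pd i ?p) x)"
    if x: "x \<in> \<Omega>" for x
  proof -
    have \<phi>t: "\<phi> t y = ?p y" if "y \<in> \<Omega>" for y using P(2)[of t y] that t closure_subset[of \<Omega>] by auto
    have "pd i (\<phi> t) y = pd i ?p y" if "y \<in> \<Omega>" for i y
      by (rule pd_cong_open[OF open_domain that \<phi>t diff[OF p]])
    then have "pd i (pd i (\<phi> t)) x = pd i (pd i ?p) x" for i
      by (rule pd_cong_open[OF open_domain x _ diff[OF Ck_on_pd[OF p]]])
    moreover have "H (t, x) = S t x" using H(2)[of t x] x t closure_subset[of \<Omega>] by auto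
    ultimately show ?thesis by (simp add: shifted_source_def time[OF x])
  qed
  then have eq: "AE x in L. H (t, x) - G (t, x) (1, 0) + M *v (\<Sum>i\<in>UNIV. pd i (pd i ?p) x) = shifted_source M S \<phi> t x"
    by (intro AE_I2) simp
  have "continuous_on UNIV (\<lambda>x. H (t, x) - G (t, x) (1, 0) + M *v (\<Sum>i\<in>UNIV. pd i (pd i ?p) x))"
  proof (intro continuous_on_add continuous_on_diff)
    show "continuous_on UNIV (\<lambda>x. H (t, x))" using Ck_on_slice[OF H(1)[of 0]] by simp
    show "continuous_on UNIV (\<lambda>x. G (t, x) (1, 0))" using Ck_on_slice[OF G(2)] by simp
    have "continuous_on UNIV (\<lambda>x. pd i (pd i ?p) x)" for i
      using Ck_on_pd[OF Ck_on_pd[OF p, of "Suc 0"], of i] by simp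
    then have "continuous_on UNIV (\<lambda>x. \<Sum>i\<in>UNIV. pd i (pd i ?p) x)" by (intro continuous_on_sum)
    then show "continuous_on UNIV (\<lambda>x. M *v (\<Sum>i\<in>UNIV. pd i (pd i ?p) x))"
      by (rule bounded_linear.continuous_on[OF matrix_vector_mul_bounded_linear])
  qed
  from lsq_cong_AE[OF continuous_in_lsq[OF continuous_on_subset[OF this subset_UNIV]] eq]
  show ?thesis .
qed

lemma sobolev_2_subset_1:
  assumes "v \<in> sobolev 2 \<Omega>"
  shows "v \<in> sobolev 1 \<Omega>"
proof -
  have "v \<in> lsq \<Omega>" "\<forall>i. \<exists>g\<in>sobolev 1 \<Omega>. weak_partial \<Omega> i v g"
    using assms unfolding numeral_2_eq_2 One_nat_def sobolev.simps(2)[of "Suc 0"] by blast+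
  then show ?thesis unfolding sobolev_1_iff[of v] using sobolev_1_lsq by blast
qed

text \<open>The initial datum inherits weak derivatives from the strong solution, with which it agrees almost
everywhere at time zero.\<close>

lemma shifted_initial_value_sobolev:
  fixes S \<phi> u :: "real \<Rightarrow> real^'d \<Rightarrow> real^'j::finite"
  assumes u: "strong_solution \<Omega> \<Gamma>D T M f S \<phi> u0 u" and T: "0 < T"
    and \<phi>: "smooth_upto ({0..T} \<times> closure \<Omega>) (\<lambda>(t, x). \<phi> t x)"
  shows "(\<lambda>x. u0 x - \<phi> 0 x) \<in> sobolev 1 \<Omega>"
proof -
  obtain P where P: "\<And>m. Ck_on m UNIV P" "\<And>s x. s \<in> {0..T} \<Longrightarrow> x \<in> closure \<Omega> \<Longrightarrow> P (s, x) = \<phi> s x"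
    by (rule smooth_uptoE[OF \<phi>]) (rule that)
  have "u 0 \<in> sobolev 2 \<Omega>" and u0: "AE x in L. u 0 x = u0 x"
    using u T unfolding strong_solution_def time_continuous_def by auto
  then have "(\<lambda>x. 1 *\<^sub>R u 0 x + (-1) *\<^sub>R P (0, x)) \<in> sobolev 1 \<Omega>"
    by (intro sobolev_1_lin sobolev_2_subset_1 Ck_in_sobolev_1 Ck_on_slice P(1))
  moreover have "P (0, x) = \<phi> 0 x" if "x \<in> \<Omega>" for x using P(2)[of 0 x] that T closure_subset[of \<Omega>] by auto
  then have "AE x in L. 1 *\<^sub>R u 0 x + (-1) *\<^sub>R P (0, x) = u0 x - \<phi> 0 x" using u0 by (auto elim: AE_mp)
  ultimately show ?thesis by (rule sobolev_1_cong_AE)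
qed

end

section \<open>The deferred correction recursion\<close>

lemma DC_solution_cong:
  assumes "\<And>i. i \<le> j \<Longrightarrow> w i = w' i"
  shows "DC_solution \<Omega> M f S \<phi> u0 Sh c e j k N w \<longleftrightarrow> DC_solution \<Omega> M f S \<phi> u0 Sh c e j k N w'"
  using assms by (induction j) simp_all

lemma corrections_in_fe_space:
  assumes "\<And>n. v n \<in> fe_space Nh \<beta>"
  shows "(\<lambda>x. Lam c j (Dseq k (\<lambda>m. v m x)) n) \<in> fe_space Nh \<beta>"
    and "(\<lambda>x. Gam c j (Eseq (\<lambda>m. v m x)) n) \<in> fe_space Nh \<beta>"
    and "(\<lambda>x. LamD_start k c j (\<lambda>m. v m x) n) \<in> fe_space Nh \<beta>"
    and "(\<lambda>x. GamE_start c j (\<lambda>m. v m x) n) \<in> fe_space Nh \<beta>"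
  unfolding Lam_def Gam_def LamD_start_def GamE_start_def Dseq_def Eseq_def Let_def
  by (intro fe_space_sum fe_space_scaleR fe_space_add fe_space_diff assms)+

text \<open>From here on only the solvability of a single step matters. The step size is left free in \<open>step\<close>,
because the starting values of each stage come from the previous stage on a finer grid.\<close>

locale solvable_scheme =
  fixes \<Omega> :: "(real^'d::finite) set" and M :: "real^'j::finite^'j" and f :: "real^'j \<Rightarrow> real^'j"
    and S \<phi> :: "real \<Rightarrow> real^'d \<Rightarrow> real^'j" and u0 :: "real^'d \<Rightarrow> real^'j"
    and Nh :: nat and \<beta> :: "nat \<Rightarrow> real^'d \<Rightarrow> real^'j" and c :: "nat \<Rightarrow> real" and e :: "nat \<Rightarrow> nat \<Rightarrow> real"
    and T \<Lambda> :: real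
  assumes step: "\<And>k t w dc ec. 0 < k \<Longrightarrow> k * \<Lambda> < 2 \<Longrightarrow> 0 < t \<Longrightarrow> t < T \<Longrightarrow> w \<in> fe_space Nh \<beta> \<Longrightarrow>
      dc \<in> fe_space Nh \<beta> \<Longrightarrow> ec \<in> fe_space Nh \<beta> \<Longrightarrow>
      \<exists>X\<in>fe_space Nh \<beta>. galerkin_eq \<Omega> M f S \<phi> (fe_space Nh \<beta>) t
        (\<lambda>x. (1 / k) *\<^sub>R (X x - w x) - dc x) (\<lambda>x. (1 / 2) *\<^sub>R (X x + w x) - ec x)"
    and initial: "R_h \<Omega> M (fe_space Nh \<beta>) (\<lambda>x. u0 x - \<phi> 0 x) \<in> fe_space Nh \<beta>"
    and \<Lambda>_nonneg: "0 \<le> \<Lambda>"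
begin

abbreviation "Sh \<equiv> fe_space Nh \<beta>"
abbreviation "DC \<equiv> DC_solution \<Omega> M f S \<phi> u0 Sh c e"

text \<open>A stage on a grid refined for the starting steps is an instance of the same problem: the smaller time
step satisfies the restriction because \<open>\<Lambda> \<ge> 0\<close>.\<close>

lemma refined_grid:
  assumes "0 < k" "k * \<Lambda> < 2" "real N * k = T" "0 < m"
  shows "0 < k / real m" "k / real m * \<Lambda> < 2" "real (m * N) * (k / real m) = T"
proof -
  show "0 < k / real m" "real (m * N) * (k / real m) = T" using assms by simp_all
  have "k / real m \<le> k" using assms by (simp add: divide_le_eq)
  then have "k / real m * \<Lambda> \<le> k * \<Lambda>" using \<Lambda>_nonneg by (rule mult_right_mono)
  then show "k / real m * \<Lambda> < 2" using assms(2) by linarith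
qed

text \<open>The corrections come from stages that are already known, so the next stage is an ordinary recursion
over the time steps. Steps for which no equation is imposed, at the end of the interval, are solved
with whatever the correction formula yields there.\<close>

lemma DC_extend:
  assumes k: "0 < k" "k * \<Lambda> < 2" "real N * k = T"
    and w: "\<And>i n. w i n \<in> Sh" "DC j k N w"
    and z: "\<And>i n. z i n \<in> Sh" "DC j (k / real (2*j+1)) ((2*j+1) * N) z"
  shows "\<exists>v. (\<forall>n. v n \<in> Sh) \<and> DC (Suc j) k N (w(Suc j := v))"
proof -
  define dc where "dc n = (if n < j then (\<lambda>x. LamD_start k (e j) j (\<lambda>m. z j m x) n)
      else (\<lambda>x. Lam c j (Dseq k (\<lambda>m. w j m x)) n))" for n
  define ec where "ec n = (if n < j then (\<lambda>x. GamE_start (e j) j (\<lambda>m. z j m x) n)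
      else (\<lambda>x. Gam c j (Eseq (\<lambda>m. w j m x)) n))" for n
  have corr: "dc n \<in> Sh" "ec n \<in> Sh" for n
    by (simp_all add: dc_def ec_def corrections_in_fe_space w z)
  let ?eq = "\<lambda>n W X. galerkin_eq \<Omega> M f S \<phi> Sh ((real n + 1/2) * k)
      (\<lambda>x. (1 / k) *\<^sub>R (X x - W x) - dc n x) (\<lambda>x. (1 / 2) *\<^sub>R (X x + W x) - ec n x)"
  have "\<exists>v. \<forall>n. (v n \<in> Sh \<and> (n = 0 \<longrightarrow> v n = R_h \<Omega> M Sh (\<lambda>x. u0 x - \<phi> 0 x))) \<and>
      (n + 1 \<le> N \<longrightarrow> ?eq n (v n) (v (Suc n)))"
  proof (rule dependent_nat_choice)
    fix W :: "real^'d \<Rightarrow> real^'j" and n :: nat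
    assume W: "W \<in> Sh \<and> (n = 0 \<longrightarrow> W = R_h \<Omega> M Sh (\<lambda>x. u0 x - \<phi> 0 x))"
    show "\<exists>X. (X \<in> Sh \<and> (Suc n = 0 \<longrightarrow> X = R_h \<Omega> M Sh (\<lambda>x. u0 x - \<phi> 0 x))) \<and> (n + 1 \<le> N \<longrightarrow> ?eq n W X)"
    proof (cases "n + 1 \<le> N")
      case True
      then have "(real n + 1/2) * k < real N * k" using k(1) by (intro mult_strict_right_mono) auto
      then show ?thesis
        using step[OF k(1,2) _ _ _ corr(1) corr(2), of "(real n + 1/2) * k" W n n] W k by auto
    qed (use W in auto)
  qed (use initial in auto)
  then obtain v where v: "\<And>n. v n \<in> Sh" "v 0 = R_h \<Omega> M Sh (\<lambda>x. u0 x - \<phi> 0 x)"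
    "\<And>n. n + 1 \<le> N \<Longrightarrow> ?eq n (v n) (v (Suc n))" by blast
  let ?w = "w(Suc j := v)"
  have prev: "DC j k N ?w" using w(2) by (subst DC_solution_cong[where w' = w]) auto
  have main: "galerkin_eq \<Omega> M f S \<phi> Sh ((real n + 1/2) * k)
      (\<lambda>x. Dseq k (\<lambda>m. v m x) n - Lam c j (Dseq k (\<lambda>m. w j m x)) n)
      (\<lambda>x. Eseq (\<lambda>m. v m x) n - Gam c j (Eseq (\<lambda>m. w j m x)) n)" if "j \<le> n" "n + j + 1 \<le> N" for n
    using v(3)[of n] that by (simp add: dc_def ec_def Dseq_def[of k "\<lambda>m. v m _"] Eseq_def[of "\<lambda>m. v m _"])
  have start: "galerkin_eq \<Omega> M f S \<phi> Sh ((real n + 1/2) * k)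
      (\<lambda>x. Dseq k (\<lambda>m. v m x) n - LamD_start k (e j) j (\<lambda>m. z j m x) n)
      (\<lambda>x. Eseq (\<lambda>m. v m x) n - GamE_start (e j) j (\<lambda>m. z j m x) n)" if "n < j" "n + 1 \<le> N" for n
    using v(3)[of n] that by (simp add: dc_def ec_def Dseq_def Eseq_def)
  have "?w j = w j" by simp
  then have "DC (Suc j) k N ?w"
    unfolding DC_solution.simps(2) fun_upd_same
    by (simp only:) (intro conjI exI[of _ z] allI impI prev v(1,2) z(2); (elim conjE)?, (intro main start, assumption+)?)
  then show ?thesis using v(1) by blast
qed

lemma DC_exists:
  assumes "0 < k" "k * \<Lambda> < 2" "real N * k = T"
  shows "\<exists>w. (\<forall>i n. w i n \<in> Sh) \<and> DC j k N w"
  using assms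
proof (induction j arbitrary: k N)
  case 0
  show ?case by (rule exI[of _ "\<lambda>_ _ _. 0"]) (simp add: fe_space_zero)
next
  case (Suc j)
  obtain z where "\<And>i n. z i n \<in> Sh" "DC j (k / real (2 * j + 1)) ((2 * j + 1) * N) z"
    using Suc.IH[OF refined_grid[OF Suc.prems, of "2 * j + 1"]] by auto
  moreover obtain w where w: "\<And>i n. w i n \<in> Sh" "DC j k N w" using Suc by blast
  ultimately obtain v where v: "\<And>n. v n \<in> Sh" "DC (Suc j) k N (w(Suc j := v))"
    using DC_extend[OF Suc.prems w] by blast
  have "(w(Suc j := v)) i n \<in> Sh" for i n using v(1) w(1) by simp
  then show ?case using v(2) by blast
qed

text \<open>A single family of sequences has to serve all orders at once, so the stages are chosen one after the
other such that earlier stages are never changed, and the diagonal is taken.\<close>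

lemma DC_exists_all:
  assumes k: "0 < k" "k * \<Lambda> < 2" "real N * k = T"
  shows "\<exists>w. (\<forall>i n. w i n \<in> Sh) \<and> (\<forall>j. DC j k N w)"
proof -
  have "\<exists>ws. \<forall>j. ((\<forall>i n. ws j i n \<in> Sh) \<and> DC j k N (ws j)) \<and> (\<forall>i\<le>j. ws (Suc j) i = ws j i)"
  proof (rule dependent_nat_choice)
    show "\<exists>w. (\<forall>i n. w i n \<in> Sh) \<and> DC 0 k N w" by (rule DC_exists[OF k])
    fix w j assume w: "(\<forall>i n. w i n \<in> Sh) \<and> DC j k N w"
    obtain z where "\<And>i n. z i n \<in> Sh" "DC j (k / real (2 * j + 1)) ((2 * j + 1) * N) z"
      using DC_exists[OF refined_grid[OF k, of "2 * j + 1"], of j] by auto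
    then obtain v where v: "\<And>n. v n \<in> Sh" "DC (Suc j) k N (w(Suc j := v))"
      using DC_extend[OF k] w by blast
    have "(w(Suc j := v)) i n \<in> Sh" for i n using v(1) w by simp
    moreover have "(w(Suc j := v)) i = w i" if "i \<le> j" for i using that by simp
    ultimately show "\<exists>w'. ((\<forall>i n. w' i n \<in> Sh) \<and> DC (Suc j) k N w') \<and> (\<forall>i\<le>j. w' i = w i)"
      using v(2) by blast
  qed
  then obtain ws where ws: "\<And>j i n. ws j i n \<in> Sh" "\<And>j. DC j k N (ws j)" "\<And>j i. i \<le> j \<Longrightarrow> ws (Suc j) i = ws j i"
    by blast
  have diag: "ws j i = ws i i" if "i \<le> j" for i j
    using that by (induction j rule: dec_induct) (simp_all add: ws(3))
  have "DC j k N (\<lambda>i. ws i i)" for j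
    by (rule iffD1[OF DC_solution_cong[of j "ws j" "\<lambda>i. ws i i", OF diag] ws(2)])
  then show ?thesis using ws(1) by (intro exI[of _ "\<lambda>i. ws i i"]) auto
qed

end

theorem theorem4:
  fixes \<Omega> \<Gamma>D :: "(real^'d) set"
    and T k \<alpha> q \<mu>0 \<mu>1 :: real and N p r Nh :: nat
    and M :: "real^'j^'j" and f :: "real^'j \<Rightarrow> real^'j" and \<tau> :: "real^'j \<Rightarrow> real"
    and S \<phi> u :: "real \<Rightarrow> real^'d \<Rightarrow> real^'j" and u0 :: "real^'d \<Rightarrow> real^'j"
    and \<beta> :: "nat \<Rightarrow> real^'d \<Rightarrow> real^'j"
    and c :: "nat \<Rightarrow> real" and e :: "nat \<Rightarrow> nat \<Rightarrow> real"
  assumes "CARD('d) \<in> {1, 2, 3}"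
    and "bounded_smooth_domain \<Omega>"
    and "\<Gamma>D \<subseteq> frontier \<Omega>"
    and "0 < T"
    and "\<forall>x. x \<noteq> 0 \<longrightarrow> 0 < (M *v x) \<bullet> x"
    and "smooth_on UNIV f"
    and "0 \<le> \<alpha>" and "1 \<le> q" and "0 \<le> \<mu>0"
    and "continuous_on UNIV \<tau>"
    and "\<forall>x y. \<alpha> * norm (x - y) powr q + \<tau> y * (norm (x - y))\<^sup>2 \<le> (f x - f y) \<bullet> (x - y)"
    and "\<forall>x y. - \<mu>0 * (norm y)\<^sup>2 \<le> frechet_derivative f (at x) y \<bullet> y"
    and "inhomogeneous_Neumann \<Omega> \<Gamma>D T \<phi> \<longrightarrow> 0 < \<mu>1 \<and> 2 \<le> q \<and> q < 18 \<and>
           (\<forall>x. onorm (frechet_derivative f (at x))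
                  \<le> \<mu>1 * (1 + (if q = 2 then 1 else norm x powr (q - 2))))"
    and "smooth_upto ({0..T} \<times> closure \<Omega>) (\<lambda>(t, x). S t x)"
    and "smooth_upto ({0..T} \<times> closure \<Omega>) (\<lambda>(t, x). \<phi> t x)"
    and "1 \<le> p" and "1 \<le> r"
    and "strong_solution \<Omega> \<Gamma>D T M f S \<phi> u0 u"
    and "\<forall>v. strong_solution \<Omega> \<Gamma>D T M f S \<phi> u0 v \<longrightarrow>
           (\<forall>t\<in>{0..T}. AE x in lebesgue_on \<Omega>. v t x = u t x)"
    and "Cm_in (2 * p + 4) T (sobolev (r + 1) \<Omega>) (sobolev_sqnorm (r + 1) \<Omega>) u"
    and "fe_basis \<Omega> \<Gamma>D r Nh \<beta>"
    and "correction_coeffs c"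
    and "\<forall>j\<ge>1. starting_coeffs j (e j)"
    and "0 < k" and "real N * k = T"
    and "k * (SUP (t, x)\<in>{0<..<T} \<times> \<Omega>. \<bar>\<tau> (\<phi> t x)\<bar>) < 2"
  shows "\<exists>U :: nat \<Rightarrow> nat \<Rightarrow> nat \<Rightarrow> real. \<forall>j\<ge>1.
           DC_solution \<Omega> M f S \<phi> u0 (fe_space Nh \<beta>) c e j k N (\<lambda>i n. fe_fun Nh \<beta> (U i n))"
proof -
  let ?Sh = "fe_space Nh \<beta>"
  define \<Lambda> where "\<Lambda> = (SUP (t, x)\<in>{0<..<T} \<times> \<Omega>. \<bar>\<tau> (\<phi> t x)\<bar>)"
  note T = \<open>0 < T\<close> and basis = \<open>fe_basis \<Omega> \<Gamma>D r Nh \<beta>\<close>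
    and S_smooth = \<open>smooth_upto ({0..T} \<times> closure \<Omega>) (\<lambda>(t, x). S t x)\<close>
    and \<phi>_smooth = \<open>smooth_upto ({0..T} \<times> closure \<Omega>) (\<lambda>(t, x). \<phi> t x)\<close>
  have domain: "open \<Omega>" "bounded \<Omega>" "\<Omega> \<noteq> {}"
    using \<open>bounded_smooth_domain \<Omega>\<close> by (auto simp: bounded_smooth_domain_def)
  interpret finite_element_space \<Omega> Nh \<beta> M
  proof
    show "\<beta> l \<in> sobolev 1 \<Omega>" if "l < Nh" for l
      using basis basis_in_fe_space[OF that, of \<beta>] unfolding fe_basis_def V_space_def by blast
  qed (use domain basis \<open>\<forall>x. x \<noteq> 0 \<longrightarrow> 0 < (M *v x) \<bullet> x\<close> in \<open>auto simp: fe_basis_def\<close>)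
  obtain P where P: "\<And>m. Ck_on m UNIV P" "\<And>s x. s \<in> {0..T} \<Longrightarrow> x \<in> closure \<Omega> \<Longrightarrow> P (s, x) = \<phi> s x"
    by (rule smooth_uptoE[OF \<phi>_smooth]) (rule that)
  have contP: "continuous_on UNIV P" by (rule Ck_on_imp_continuous_on[OF P(1)])
  have "compact ((\<lambda>p. \<bar>\<tau> (P p)\<bar>) ` ({0..T} \<times> closure \<Omega>))"
    using domain(2) by (intro compact_continuous_image compact_Times continuous_on_rabs
        continuous_on_compose2[OF \<open>continuous_on UNIV \<tau>\<close>] continuous_on_subset[OF contP]) auto
  then have "bdd_above ((\<lambda>p. \<bar>\<tau> (P p)\<bar>) ` ({0..T} \<times> closure \<Omega>))"
    by (intro bounded_imp_bdd_above compact_imp_bounded)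
  moreover have "(\<lambda>(t, x). \<bar>\<tau> (\<phi> t x)\<bar>) ` ({0<..<T} \<times> \<Omega>) \<subseteq> (\<lambda>p. \<bar>\<tau> (P p)\<bar>) ` ({0..T} \<times> closure \<Omega>)"
  proof clarify
    fix t x assume "t \<in> {0<..<T}" "x \<in> \<Omega>"
    then show "\<bar>\<tau> (\<phi> t x)\<bar> \<in> (\<lambda>p. \<bar>\<tau> (P p)\<bar>) ` ({0..T} \<times> closure \<Omega>)"
      using P(2)[of t x] closure_subset[of \<Omega>] by (intro image_eqI[of _ _ "(t, x)"]) auto
  qed
  ultimately have bdd: "bdd_above ((\<lambda>(t, x). \<bar>\<tau> (\<phi> t x)\<bar>) ` ({0<..<T} \<times> \<Omega>))"
    by (rule bdd_above_mono)
  have \<Lambda>: "\<bar>\<tau> (\<phi> t x)\<bar> \<le> \<Lambda>" if "0 < t" "t < T" "x \<in> \<Omega>" for t x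
    unfolding \<Lambda>_def using cSUP_upper[OF _ bdd, of "(t, x)"] that by simp
  \<comment> \<open>The supremum is over a nonempty set, hence nonnegative; the refined grids need this.\<close>
  obtain x0 where x0: "x0 \<in> \<Omega>" using domain(3) by blast
  have "0 \<le> \<Lambda>" using \<Lambda>[of "T / 2" x0] x0 T by linarith
  have contf: "continuous_on UNIV f"
    using \<open>smooth_on UNIV f\<close> Ck_on_imp_continuous_on by (auto simp: smooth_on_def)
  interpret scheme: solvable_scheme \<Omega> M f S \<phi> u0 Nh \<beta> c e T \<Lambda>
  proof
    show "0 \<le> \<Lambda>" by fact
    show "R_h \<Omega> M ?Sh (\<lambda>x. u0 x - \<phi> 0 x) \<in> ?Sh"
      by (rule R_h_in_fe_space[OF shifted_initial_value_sobolev[OF \<open>strong_solution \<Omega> \<Gamma>D T M f S \<phi> u0 u\<close> T \<phi>_smooth]])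
    fix k t w dc ec
    assume k: "0 < k" "k * \<Lambda> < 2" and t: "0 < t" "t < T" and Sh: "w \<in> ?Sh" "dc \<in> ?Sh" "ec \<in> ?Sh"
    have cont\<phi>: "continuous_on (closure \<Omega>) (\<phi> t)"
    proof -
      have "continuous_on (closure \<Omega>) (\<lambda>x. P (t, x))"
        by (rule continuous_on_compose2[OF contP]) (auto intro!: continuous_intros)
      then show ?thesis by (rule continuous_on_eq) (use P(2) t in auto)
    qed
    have monotone: "- \<Lambda> * (norm y)\<^sup>2 \<le> (f (y + \<phi> t x) - f (\<phi> t x)) \<bullet> y" if x: "x \<in> \<Omega>" for x y
    proof -
      have "\<alpha> * norm (y + \<phi> t x - \<phi> t x) powr q + \<tau> (\<phi> t x) * (norm (y + \<phi> t x - \<phi> t x))\<^sup>2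
          \<le> (f (y + \<phi> t x) - f (\<phi> t x)) \<bullet> (y + \<phi> t x - \<phi> t x)"
        using \<open>\<forall>x y. \<alpha> * norm (x - y) powr q + \<tau> y * (norm (x - y))\<^sup>2 \<le> (f x - f y) \<bullet> (x - y)\<close> by blast
      moreover have "0 \<le> \<alpha> * norm y powr q" using \<open>0 \<le> \<alpha>\<close> by simp
      moreover have "- \<Lambda> * (norm y)\<^sup>2 \<le> \<tau> (\<phi> t x) * (norm y)\<^sup>2"
        using \<Lambda>[OF t x] by (intro mult_right_mono) auto
      ultimately show ?thesis by simp
    qed
    show "\<exists>X\<in>?Sh. galerkin_eq \<Omega> M f S \<phi> ?Sh t
        (\<lambda>x. (1 / k) *\<^sub>R (X x - w x) - dc x) (\<lambda>x. (1 / 2) *\<^sub>R (X x + w x) - ec x)"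
    proof (rule crank_nicolson_step_solvable[OF contf cont\<phi> shifted_source_lsq[OF S_smooth \<phi>_smooth t] monotone k Sh])
      fix X assume "X \<in> ?Sh" and "\<And>\<psi>. \<psi> \<in> ?Sh \<Longrightarrow>
        l2_inner \<Omega> (\<lambda>x. (1 / k) *\<^sub>R (X x - w x) - dc x) \<psi>
          + grad_inner \<Omega> M (\<lambda>x. (1 / 2) *\<^sub>R (X x + w x) - ec x) \<psi>
          + l2_inner \<Omega> (\<lambda>x. f ((1 / 2) *\<^sub>R (X x + w x) - ec x + \<phi> t x)) \<psi>
        = l2_inner \<Omega> (shifted_source M S \<phi> t) \<psi>"
      then show ?thesis unfolding galerkin_eq_def by (intro bexI[of _ X] ballI)
    qed
  qed
  obtain w where w: "\<And>i n. w i n \<in> ?Sh" "\<And>j. scheme.DC j k N w"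
    using scheme.DC_exists_all[of k N] \<open>0 < k\<close> \<open>real N * k = T\<close>
      \<open>k * (SUP (t, x)\<in>{0<..<T} \<times> \<Omega>. \<bar>\<tau> (\<phi> t x)\<bar>) < 2\<close> unfolding \<Lambda>_def by blast
  have "\<exists>V. w i n = fe_fun Nh \<beta> V" for i n using w(1)[of i n] by (auto simp: fe_space_def)
  then obtain U where "\<And>i n. w i n = fe_fun Nh \<beta> (U i n)" by metis
  then have "w = (\<lambda>i n. fe_fun Nh \<beta> (U i n))" by (simp add: fun_eq_iff)
  then show ?thesis using w(2) by auto
qed

end
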